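(* Let $(Y,Y^\diamond)$ be a norming dual pair that is suitable for twin perturbation, let $\{S_0(t)\}_{t\ge 0}$ be a twin semigroup on $(Y,Y^\diamond)$ with (possibly multi-valued) generator $C_0$, and let $q_1,\dots,q_n\in Y$ and $q_1^\diamond,\dots,q_n^\diamond\in Y^\diamond$ be given. Let $k:[0,\infty)\to\mathbb R^{n\times n}$, $k_{ij}(t)=q_i^\diamond S_0(t)q_j$, and let $r$ be its resolvent, i.e. the unique locally bounded measurable solution of $k+k\ast r=r=k+r\ast k$ (with $\ast$ the usual convolution of functions on $[0,\infty)$). For $y\in Y$, $y^\diamond\in Y^\diamond$ and $t\ge 0$ define $$v_i(t)y=q_i^\diamond S_0(t)y+\sum_{j=1}^n\int_0^t r_{ij}(t-\tau)\,q_j^\diamond S_0(\tau)y\,d\tau ,\qquad y^\diamond w_j(t)=y^\diamond S_0(t)q_j+\sum_{i=1}^n\int_0^t y^\diamond S_0(t-\tau)q_i\,r_{ij}(\tau)\,d\tau .$$ Then the formula $$y^\diamond S(t)y=y^\diamond S_0(t)y+\sum_{j=1}^n\int_0^t y^\diamond S_0(t-\tau)q_j\;v_j(\tau)y\,d\tau$$ or, equivalently, the formula $$y^\diamond S(t)y=y^\diamond S_0(t)y+\sum_{j=1}^n\int_0^t y^\diamond w_j(t-\tau)\;q_j^\diamond S_0(\tau)y\,d\tau$$ defines a twin semigroup $\{S(t)\}_{t\ge0}$ on $(Y,Y^\diamond)$ whose generator $C$ is given by $$\mathcal D(C)=\mathcal D(C_0),\qquad Cy=C_0y+\sum_{j=1}^n\langle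 q_j^\diamond,y\rangle q_j .$$
   Context: Spaces are real; for non-real $\lambda$ complexifications are used. Banach spaces $Y,Y^\diamond$ form a norming dual pair if there is a bilinear map $\langle\cdot,\cdot\rangle:Y^\diamond\times Y\to\mathbb R$ with $|\langle y^\diamond,y\rangle|\le M\|y^\diamond\|\|y\|$ for some $M\ge1$, $\|y\|=\sup\{|\langle y^\diamond,y\rangle|:\|y^\diamond\|\le1\}$ and $\|y^\diamond\|=\sup\{|\langle y^\diamond,y\rangle|:\|y\|\le1\}$. $\sigma(Y,Y^\diamond)$ is the weak topology on $Y$ induced by $Y^\diamond$; $\sigma(Y^\diamond,Y)$ the one on $Y^\diamond$ induced by $Y$. A twin operator $L$ is a bounded bilinear map $Y^\diamond\times Y\to\mathbb R$, $(y^\diamond,y)\mapsto y^\diamond Ly$, such that for each $y$ there is $Ly\in Y$ with $\langle y^\diamond,Ly\rangle=y^\diamond Ly$ for all $y^\diamond$, and for each $y^\diamond$ there is $y^\diamond L\in Y^\diamond$ with $\langle y^\diamond L,y\rangle=y^\diamond Ly$ for all $y$. Composition: $y^\diamond L_1L_2y:=\langle y^\diamond L_1,L_2y\rangle$. A twin semigroup is a family $\{S(t)\}_{t\ge0}$ of twin operators with: (i) $S(0)=I$, $S(t+s)=S(t)S(s)$; (ii) $|y^\diamond S(t)y|\le Me^{\omega t}\|y\|\|y^\diamond\|$ for some $M\ge1,\omega\in\mathbb R$; (iii) $t\mapsto y^\diamond S(t)y$ is (Borel) measurable for all $y,y^\diamond$; (iv) for $\operatorname{Re}\lambda>\omega$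 there is a twin operator $\overline S(\lambda)$ with $y^\diamond\overline S(\lambda)y=\int_0^\infty e^{-\lambda t}y^\diamond S(t)y\,dt$. Its generator is the (possibly multi-valued) linear operator $C$ on $Y$ with $(\lambda I-C)^{-1}=\overline S(\lambda)$, i.e. $y\in\mathcal D(C)$ and $z\in Cy$ iff $y=\overline S(\lambda)(\lambda y-z)$ (independent of $\lambda$). The pair $(Y,Y^\diamond)$ is suitable for twin perturbation if (a) $(Y,\sigma(Y,Y^\diamond))$ is sequentially complete, or every sequentially continuous linear map $(Y^\diamond,\sigma(Y^\diamond,Y))\to\mathbb R$ is continuous; and (b) $(Y^\diamond,\sigma(Y^\diamond,Y))$ is sequentially complete, or every sequentially continuous linear map $(Y,\sigma(Y,Y^\diamond))\to\mathbb R$ is continuous. If $C_0$ is multi-valued, $Cy$ means $\{z+\sum_j\langle q_j^\diamond,y\rangle q_j: z\in C_0y\}$. *)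

theory Defs
  imports "HOL-Analysis.Analysis"
begin

text \<open>
  Throughout, \<open>'a\<close> plays the role of $Y$, \<open>'b\<close> that of its dual partner, and
  \<open>p y' y\<close> is the pairing of \<open>y'\<close> in \<open>'b\<close> with \<open>y\<close> in \<open>'a\<close>.
\<close>

definition norming_dual_pair :: "('b::banach \<Rightarrow> 'a::banach \<Rightarrow> real) \<Rightarrow> bool" where
  "norming_dual_pair p \<longleftrightarrow>
     bilinear p \<and>
     (\<exists>M\<ge>1. \<forall>y' y. \<bar>p y' y\<bar> \<le> M * norm y' * norm y) \<and>
     (\<forall>y. norm y = (SUP y'\<in>{y'. norm y' \<le> 1}. \<bar>p y' y\<bar>)) \<and>
     (\<forall>y'. norm y' = (SUP y\<in>{y. norm y \<le> 1}. \<bar>p y' y\<bar>))"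

subsection \<open>Weak topologies and suitability for twin perturbation\<close>

definition initial_topology :: "('c \<Rightarrow> real) set \<Rightarrow> 'c topology" where
  "initial_topology F = topology_generated_by {f -` U | f U. f \<in> F \<and> open U}"

definition sigma_Y :: "('b \<Rightarrow> 'a \<Rightarrow> real) \<Rightarrow> 'a topology" where
  "sigma_Y p = initial_topology (range p)"

definition sigma_dual :: "('b \<Rightarrow> 'a \<Rightarrow> real) \<Rightarrow> 'b topology" where
  "sigma_dual p = initial_topology (range (\<lambda>y y'. p y' y))"

text \<open>Cauchy sequences for the uniformity of a vector space topology.\<close>

definition tvs_Cauchy :: "'c::real_vector topology \<Rightarrow> (nat \<Rightarrow> 'c) \<Rightarrow> bool" where
  "tvs_Cauchy T x \<longleftrightarrow>
     (\<forall>U. openin T U \<and> 0 \<in> U \<longrightarrow> (\<exists>N. \<forall>m\<ge>N. \<forall>n\<ge>N. x m - x n \<in> U))"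

definition sequentially_complete :: "'c::real_vector topology \<Rightarrow> bool" where
  "sequentially_complete T \<longleftrightarrow> (\<forall>x. tvs_Cauchy T x \<longrightarrow> (\<exists>l. limitin T x l sequentially))"

definition sequentially_continuous :: "'c topology \<Rightarrow> ('c \<Rightarrow> real) \<Rightarrow> bool" where
  "sequentially_continuous T f \<longleftrightarrow>
     (\<forall>x l. limitin T x l sequentially \<longrightarrow> (\<lambda>n. f (x n)) \<longlonglongrightarrow> f l)"

definition seq_cont_functionals_cont :: "'c::real_vector topology \<Rightarrow> bool" where
  "seq_cont_functionals_cont T \<longleftrightarrow>
     (\<forall>f. linear f \<and> sequentially_continuous T f \<longrightarrow> continuous_map T euclideanreal f)"

definition suitable_for_twin_perturbation ::
    "('b::real_vector \<Rightarrow> 'a::real_vector \<Rightarrow> real) \<Rightarrow> bool" where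
  "suitable_for_twin_perturbation p \<longleftrightarrow>
     (sequentially_complete (sigma_Y p) \<or> seq_cont_functionals_cont (sigma_dual p)) \<and>
     (sequentially_complete (sigma_dual p) \<or> seq_cont_functionals_cont (sigma_Y p))"

subsection \<open>Twin operators\<close>

text \<open>
  The scalar type \<open>'k\<close> below is \<open>real\<close> for the spaces themselves and \<open>complex\<close> for
  their complexifications.
\<close>

definition represented :: "('b \<Rightarrow> 'a \<Rightarrow> 'k) \<Rightarrow> ('b \<Rightarrow> 'a \<Rightarrow> 'k) \<Rightarrow> bool" where
  "represented p L \<longleftrightarrow>
     (\<forall>y. \<exists>z. \<forall>y'. p y' z = L y' y) \<and> (\<forall>y'. \<exists>z'. \<forall>y. p z' y = L y' y)"

text \<open>
  \<open>act_right p L y\<close> is $Ly$ and \<open>act_left p L y'\<close> is $y'L$. For a norming dual pair and a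
  twin operator the described elements exist and are unique.
\<close>

definition act_right :: "('b \<Rightarrow> 'a \<Rightarrow> 'k) \<Rightarrow> ('b \<Rightarrow> 'a \<Rightarrow> 'k) \<Rightarrow> 'a \<Rightarrow> 'a" where
  "act_right p L y = (THE z. \<forall>y'. p y' z = L y' y)"

definition act_left :: "('b \<Rightarrow> 'a \<Rightarrow> 'k) \<Rightarrow> ('b \<Rightarrow> 'a \<Rightarrow> 'k) \<Rightarrow> 'b \<Rightarrow> 'b" where
  "act_left p L y' = (THE z'. \<forall>y. p z' y = L y' y)"

definition twin_operator ::
    "('b::banach \<Rightarrow> 'a::banach \<Rightarrow> real) \<Rightarrow> ('b \<Rightarrow> 'a \<Rightarrow> real) \<Rightarrow> bool" where
  "twin_operator p L \<longleftrightarrow> bounded_bilinear L \<and> represented p L"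

definition twin_comp ::
    "('b \<Rightarrow> 'a \<Rightarrow> real) \<Rightarrow> ('b \<Rightarrow> 'a \<Rightarrow> real) \<Rightarrow> ('b \<Rightarrow> 'a \<Rightarrow> real) \<Rightarrow> 'b \<Rightarrow> 'a \<Rightarrow> real" where
  "twin_comp p L\<^sub>1 L\<^sub>2 y' y = p (act_left p L\<^sub>1 y') (act_right p L\<^sub>2 y)"

subsection \<open>Complexification\<close>

text \<open>
  The complexification of a real space is the space of pairs \<open>(x, y)\<close>, standing for $x + iy$.
  Its norm enters only through boundedness of bilinear maps, so the product norm may be used
  in place of any of the equivalent complex-homogeneous norms.
\<close>

definition cscale :: "complex \<Rightarrow> 'c::real_vector \<times> 'c \<Rightarrow> 'c \<times> 'c" where
  "cscale c u = (Re c *\<^sub>R fst u - Im c *\<^sub>R snd u, Im c *\<^sub>R fst u + Re c *\<^sub>R snd u)"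

definition complexify_form ::
    "('b \<Rightarrow> 'a \<Rightarrow> real) \<Rightarrow> 'b \<times> 'b \<Rightarrow> 'a \<times> 'a \<Rightarrow> complex" where
  "complexify_form B u' u =
     Complex (B (fst u') (fst u) - B (snd u') (snd u))
             (B (fst u') (snd u) + B (snd u') (fst u))"

definition complexify_rel :: "('a \<times> 'a) set \<Rightarrow> (('a \<times> 'a) \<times> ('a \<times> 'a)) set" where
  "complexify_rel C = {(y, z). (fst y, fst z) \<in> C \<and> (snd y, snd z) \<in> C}"

definition complex_twin_operator ::
    "('b::banach \<Rightarrow> 'a::banach \<Rightarrow> real) \<Rightarrow> ('b \<times> 'b \<Rightarrow> 'a \<times> 'a \<Rightarrow> complex) \<Rightarrow> bool" where
  "complex_twin_operator p L \<longleftrightarrow>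
     bounded_bilinear L \<and>
     (\<forall>c u' u. L (cscale c u') u = c * L u' u \<and> L u' (cscale c u) = c * L u' u) \<and>
     represented (complexify_form p) L"

subsection \<open>Twin semigroups and their generators\<close>

text \<open>
  A family indexed by $[0,\infty)$ is a function on \<open>real\<close> whose values at negative
  arguments are irrelevant.
\<close>

definition laplace ::
    "(real \<Rightarrow> 'b \<Rightarrow> 'a \<Rightarrow> real) \<Rightarrow> complex \<Rightarrow> 'b \<times> 'b \<Rightarrow> 'a \<times> 'a \<Rightarrow> complex" where
  "laplace S \<zeta> u' u =
     (LINT t:{0..}|lborel. exp (- \<zeta> * of_real t) * complexify_form (S t) u' u)"

definition twin_semigroup_with ::
    "real \<Rightarrow> real \<Rightarrow> ('b::banach \<Rightarrow> 'a::banach \<Rightarrow> real) \<Rightarrow> (real \<Rightarrow> 'b \<Rightarrow> 'a \<Rightarrow> real) \<Rightarrow> bool" where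
  "twin_semigroup_with M \<omega> p S \<longleftrightarrow>
     (\<forall>t\<ge>0. twin_operator p (S t)) \<and>
     S 0 = p \<and>
     (\<forall>t\<ge>0. \<forall>s\<ge>0. S (t + s) = twin_comp p (S t) (S s)) \<and>
     M \<ge> 1 \<and>
     (\<forall>t\<ge>0. \<forall>y' y. \<bar>S t y' y\<bar> \<le> M * exp (\<omega> * t) * norm y * norm y') \<and>
     (\<forall>y' y. (\<lambda>t. S t y' y) \<in> borel_measurable (restrict_space borel {0..})) \<and>
     (\<forall>\<zeta>. Re \<zeta> > \<omega> \<longrightarrow> complex_twin_operator p (laplace S \<zeta>))"

definition twin_semigroup ::
    "('b::banach \<Rightarrow> 'a::banach \<Rightarrow> real) \<Rightarrow> (real \<Rightarrow> 'b \<Rightarrow> 'a \<Rightarrow> real) \<Rightarrow> bool" where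
  "twin_semigroup p S \<longleftrightarrow> (\<exists>M \<omega>. twin_semigroup_with M \<omega> p S)"

text \<open>
  A multi-valued operator is its graph \<open>C\<close>: the pair \<open>(y, z)\<close> is in \<open>C\<close> iff $z \in Cy$,
  the domain is \<open>Domain C\<close> and the value at \<open>y\<close> is \<open>C `` {y}\<close>.
\<close>

definition is_twin_generator ::
    "('b::banach \<Rightarrow> 'a::banach \<Rightarrow> real) \<Rightarrow> (real \<Rightarrow> 'b \<Rightarrow> 'a \<Rightarrow> real) \<Rightarrow> ('a \<times> 'a) set \<Rightarrow> bool" where
  "is_twin_generator p S C \<longleftrightarrow>
     subspace C \<and>
     (\<exists>M \<omega>. twin_semigroup_with M \<omega> p S \<and>
        (\<forall>\<zeta>. Re \<zeta> > \<omega> \<longrightarrow>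
           (\<forall>y z. (y, z) \<in> complexify_rel C \<longleftrightarrow>
              y = act_right (complexify_form p) (laplace S \<zeta>) (cscale \<zeta> y - z))))"

subsection \<open>Resolvent kernel and the perturbed family\<close>

definition conv ::
    "(real \<Rightarrow> real^'n^'n) \<Rightarrow> (real \<Rightarrow> real^'n^'n) \<Rightarrow> real \<Rightarrow> real^'n^'n" where
  "conv f g t = (LINT \<tau>:{0..t}|lborel. f (t - \<tau>) ** g \<tau>)"

text \<open>The two equations determine \<open>r\<close> at every point of $[0,\infty)$.\<close>

definition is_resolvent :: "(real \<Rightarrow> real^'n^'n) \<Rightarrow> (real \<Rightarrow> real^'n^'n) \<Rightarrow> bool" where
  "is_resolvent k r \<longleftrightarrow>
     r \<in> borel_measurable (restrict_space borel {0..}) \<and>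
     (\<forall>T. bounded (r ` {0..T})) \<and>
     (\<forall>t\<ge>0. k t + conv k r t = r t \<and> r t = k t + conv r k t)"

definition pert_kernel ::
    "(real \<Rightarrow> 'b \<Rightarrow> 'a \<Rightarrow> real) \<Rightarrow> ('n \<Rightarrow> 'a) \<Rightarrow> ('n \<Rightarrow> 'b) \<Rightarrow> real \<Rightarrow> real^'n^'n" where
  "pert_kernel S\<^sub>0 q q' t = (\<chi> i j. S\<^sub>0 t (q' i) (q j))"

definition pert_v ::
    "(real \<Rightarrow> 'b \<Rightarrow> 'a \<Rightarrow> real) \<Rightarrow> ('n::finite \<Rightarrow> 'b) \<Rightarrow> (real \<Rightarrow> real^'n^'n) \<Rightarrow>
     'n \<Rightarrow> real \<Rightarrow> 'a \<Rightarrow> real" where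
  "pert_v S\<^sub>0 q' r i t y =
     S\<^sub>0 t (q' i) y +
     (\<Sum>j\<in>UNIV. LINT \<tau>:{0..t}|lborel. r (t - \<tau>) $ i $ j * S\<^sub>0 \<tau> (q' j) y)"

definition pert_w ::
    "(real \<Rightarrow> 'b \<Rightarrow> 'a \<Rightarrow> real) \<Rightarrow> ('n::finite \<Rightarrow> 'a) \<Rightarrow> (real \<Rightarrow> real^'n^'n) \<Rightarrow>
     'n \<Rightarrow> real \<Rightarrow> 'b \<Rightarrow> real" where
  "pert_w S\<^sub>0 q r j t y' =
     S\<^sub>0 t y' (q j) +
     (\<Sum>i\<in>UNIV. LINT \<tau>:{0..t}|lborel. S\<^sub>0 (t - \<tau>) y' (q i) * r \<tau> $ i $ j)"

definition pert_semigroup ::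
    "(real \<Rightarrow> 'b \<Rightarrow> 'a \<Rightarrow> real) \<Rightarrow> ('n::finite \<Rightarrow> 'a) \<Rightarrow> ('n \<Rightarrow> 'b) \<Rightarrow> (real \<Rightarrow> real^'n^'n) \<Rightarrow>
     real \<Rightarrow> 'b \<Rightarrow> 'a \<Rightarrow> real" where
  "pert_semigroup S\<^sub>0 q q' r t y' y =
     S\<^sub>0 t y' y +
     (\<Sum>j\<in>UNIV. LINT \<tau>:{0..t}|lborel. S\<^sub>0 (t - \<tau>) y' (q j) * pert_v S\<^sub>0 q' r j \<tau> y)"

definition pert_semigroup' ::
    "(real \<Rightarrow> 'b \<Rightarrow> 'a \<Rightarrow> real) \<Rightarrow> ('n::finite \<Rightarrow> 'a) \<Rightarrow> ('n \<Rightarrow> 'b) \<Rightarrow> (real \<Rightarrow> real^'n^'n) \<Rightarrow>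
     real \<Rightarrow> 'b \<Rightarrow> 'a \<Rightarrow> real" where
  "pert_semigroup' S\<^sub>0 q q' r t y' y =
     S\<^sub>0 t y' y +
     (\<Sum>j\<in>UNIV. LINT \<tau>:{0..t}|lborel. pert_w S\<^sub>0 q r j (t - \<tau>) y' * S\<^sub>0 \<tau> (q' j) y)"

end

theory Submission
  imports Defs
begin

text \<open>
  The perturbed family is the solution of a Volterra equation, and every claim about it reduces
  to algebra in the convolution algebra of exponentially bounded functions on the half line,
  plus one analytic fact on weak integrals.

  Write $g_j = y^\diamond S_0 q_j$, $h_j = q_j^\diamond S_0 y$ and $k_{ij} = q_i^\diamond S_0 q_j$
  as functions of time. Then $v = h + r * h$, $w = g + g * r$, and both formulas for the perturbed
  family expand to $y^\diamond S_0 y + g * h + g * r * h$; their equality is associativity of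
  convolution (\<open>perturbed_orbit_eq_W\<close>). A contraction argument in a fast exponential weight
  shows that the locally bounded $r$ is exponentially bounded (\<open>R_dominated\<close>), hence so is
  the perturbed family.

  \<^emph>\<open>Representability.\<close> $S(t)y$ has to be an element of the space and not merely a
  functional, so weak integrals $\int f(s)\, S_0(s) q\, ds$ must be represented. The Laplace
  transforms of $S_0$ provide this for $f(s) = e^{-\lambda s}$. The representing elements depend
  continuously on $f$ in a weighted $L^1$ norm, because the norm is the dual norm, and the
  exponentials span a dense subspace; completeness does the rest
  (\<open>weak_integral_representable\<close>). The first formula gives $S(t)y$ and the second one
  $y^\diamond S(t)$.

  \<^emph>\<open>Semigroup law.\<close> The resolvent equations say that $v = h + r * h$ is the only
  solution of the renewal equation $v = h + k * v$. Splitting a convolution on \<open>{0..t+s}\<close>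
  at $s$ shows that $v(\cdot + s) y$ solves the renewal equation with $y$ replaced by $S(s)y$.
  Hence $v(t+s)y = v(t)S(s)y$ (\<open>translate_V\<close>), and substituting this in the formula for
  $S(t+s)$ gives the law.

  \<^emph>\<open>Generator.\<close> Laplace transformation turns convolutions into products, so the
  transform of $S$ is a finite rank perturbation of the transform $L_0$ of $S_0$, with coefficient
  matrix $D = I + \hat r = (I - \hat k)^{-1}$ (\<open>laplace_perturbed\<close>). Solving an
  $n \times n$ linear system then identifies $y = Lx$ with
  $y = L_0 (x + \sum_j \langle q_j^\diamond, y\rangle q_j)$ (\<open>perturbed_resolvent_iff\<close>),
  which is the asserted relation between the generators.
\<close>

section \<open>Convolution of causal functions\<close>

text \<open>A function on the half line is extended by zero, which turns convolution over \<open>{0..t}\<close>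
  into convolution over the whole line.\<close>

definition causal :: "(real \<Rightarrow> real) \<Rightarrow> real \<Rightarrow> real" where
  "causal f t = (if 0 \<le> t then f t else 0)"

text \<open>The constants stay explicit here because the bound on a twin semigroup must be uniform in the
  two vectors; \<open>exp_bounded\<close> below hides them wherever only integrability matters.\<close>

definition exp_dominated :: "real \<Rightarrow> real \<Rightarrow> (real \<Rightarrow> real) \<Rightarrow> bool" where
  "exp_dominated a A F \<longleftrightarrow>
     F \<in> borel_measurable borel \<and> (\<forall>t<0. F t = 0) \<and> (\<forall>t\<ge>0. \<bar>F t\<bar> \<le> A * exp (a * t))"

definition exp_bounded :: "(real \<Rightarrow> real) \<Rightarrow> bool" where
  "exp_bounded F \<longleftrightarrow> (\<exists>a A. exp_dominated a A F)"

definition convolve :: "(real \<Rightarrow> real) \<Rightarrow> (real \<Rightarrow> real) \<Rightarrow> real \<Rightarrow> real"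
    (infixl "\<star>" 70) where
  "(F \<star> G) t = (LINT s|lborel. F (t - s) * G s)"

text \<open>The function seen by a process that is restarted at time \<open>s\<close>.\<close>

definition translate :: "real \<Rightarrow> (real \<Rightarrow> real) \<Rightarrow> real \<Rightarrow> real" where
  "translate s F = causal (\<lambda>t. F (t + s))"

lemma causal_nonneg [simp]: "0 \<le> t \<Longrightarrow> causal f t = f t"
  and causal_neg [simp]: "t < 0 \<Longrightarrow> causal f t = 0"
  by (auto simp: causal_def)

lemma measurable_causal:
  assumes "f \<in> borel_measurable (restrict_space borel {0..})"
  shows "causal f \<in> borel_measurable borel"
proof -
  have "(\<lambda>t. indicator {0..} t *\<^sub>R f t) \<in> borel_measurable borel"
    using assms by (subst (asm) borel_measurable_restrict_space_iff) auto
  also have "(\<lambda>t. indicator {0..} t *\<^sub>R f t) = causal f"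
    by (auto simp: causal_def indicator_def)
  finally show ?thesis .
qed

lemma exp_dominatedD:
  assumes "exp_dominated a A F"
  shows "F \<in> borel_measurable borel" "\<And>t. t < 0 \<Longrightarrow> F t = 0"
    "\<And>t. 0 \<le> t \<Longrightarrow> \<bar>F t\<bar> \<le> A * exp (a * t)" "0 \<le> A" "\<bar>F t\<bar> \<le> A * exp (a * t)"
proof -
  show "F \<in> borel_measurable borel" "\<And>t. t < 0 \<Longrightarrow> F t = 0"
    and *: "\<And>t. 0 \<le> t \<Longrightarrow> \<bar>F t\<bar> \<le> A * exp (a * t)"
    using assms by (auto simp: exp_dominated_def)
  from *[of 0] show "0 \<le> A" by simp
  then show "\<bar>F t\<bar> \<le> A * exp (a * t)"
    using * assms by (cases "0 \<le> t") (auto simp: exp_dominated_def)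
qed

lemma exp_dominated_mono:
  assumes "exp_dominated a A F" "a \<le> b" "A \<le> B"
  shows "exp_dominated b B F"
proof -
  have "A * exp (a * t) \<le> B * exp (b * t)" if "0 \<le> t" for t
    using that assms exp_dominatedD(4)[OF assms(1)]
    by (intro mult_mono) (auto intro: mult_right_mono)
  then show ?thesis
    using assms unfolding exp_dominated_def by (meson order_trans)
qed

lemma exp_dominated_add:
  assumes "exp_dominated a A F" "exp_dominated a B G"
  shows "exp_dominated a (A + B) (\<lambda>t. F t + G t)"
proof -
  have "\<bar>F t + G t\<bar> \<le> (A + B) * exp (a * t)" for t
    using exp_dominatedD(5)[OF assms(1), of t] exp_dominatedD(5)[OF assms(2), of t]
    by (auto simp: distrib_right)
  then show ?thesis
    using assms unfolding exp_dominated_def by auto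
qed

lemma exp_dominated_sum:
  assumes "\<And>i. i \<in> I \<Longrightarrow> exp_dominated a (A i) (F i)"
  shows "exp_dominated a (\<Sum>i\<in>I. A i) (\<lambda>t. \<Sum>i\<in>I. F i t)"
  using assms
proof (induction I rule: infinite_finite_induct)
  case (insert i I)
  then show ?case by (auto intro!: exp_dominated_add)
qed (auto simp: exp_dominated_def)

lemma exp_dominated_translate:
  assumes F: "exp_dominated a A F" and "0 \<le> s"
  shows "exp_dominated a (A * exp (a * s)) (translate s F)"
proof -
  have [measurable]: "F \<in> borel_measurable borel" by (rule exp_dominatedD[OF F])
  have "translate s F = (\<lambda>t. if 0 \<le> t then F (t + s) else 0)"
    by (auto simp: translate_def causal_def)
  then have "translate s F \<in> borel_measurable borel" by simp
  moreover have "\<bar>F (t + s)\<bar> \<le> A * exp (a * s) * exp (a * t)" for t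
    using exp_dominatedD(5)[OF F, of "t + s"] by (simp add: exp_add algebra_simps)
  ultimately show ?thesis
    by (auto simp: exp_dominated_def translate_def)
qed

text \<open>The source of the integrable majorants below and of the constant in \<open>convolve_bound\<close>.\<close>

lemma has_integral_exp_neg_causal:
  fixes c :: real
  assumes "0 < c"
  shows "has_bochner_integral lborel (causal (\<lambda>t. exp (- (c * t)))) (1 / c)"
proof (rule has_bochner_integral_nn_integral)
  have "((\<lambda>t. exp (- c * t)) has_integral exp (- c * 0) / c) {0..}"
    using assms by (rule has_integral_exp_minus_to_infinity)
  then have "((\<lambda>t. if t \<in> {0..} then exp (- c * t) else 0) has_integral 1 / c) UNIV"
    by (subst has_integral_restrict_UNIV) simp
  also have "(\<lambda>t. if t \<in> {0..} then exp (- c * t) else 0) = causal (\<lambda>t. exp (- (c * t)))"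
    by (auto simp: causal_def)
  finally have *: "(causal (\<lambda>t. exp (- (c * t))) has_integral 1 / c) UNIV" .
  show meas: "causal (\<lambda>t. exp (- (c * t))) \<in> borel_measurable lborel"
    using measurable_causal[of "\<lambda>t. exp (- (c * t))"] by (simp add: measurable_restrict_space1)
  show "(\<integral>\<^sup>+ t. ennreal (causal (\<lambda>t. exp (- (c * t))) t) \<partial>lborel) = ennreal (1 / c)"
    using meas by (intro nn_integral_has_integral_lborel *) (auto simp: causal_def)
qed (use assms in \<open>auto simp: causal_def\<close>)

lemma integrable_convolution_integrand:
  assumes F: "exp_dominated a A F" and G: "exp_dominated b B G"
  shows "integrable lborel (\<lambda>s. F (t - s) * G s)"
proof -
  have [measurable]: "F \<in> borel_measurable borel" "G \<in> borel_measurable borel"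
    using assms by (auto dest: exp_dominatedD(1))
  have AB: "0 \<le> A" "0 \<le> B" using assms by (auto dest: exp_dominatedD(4))
  have *: "\<bar>F (t - s) * G s\<bar> \<le> (A * exp (\<bar>a\<bar> * t)) * (B * exp (\<bar>b\<bar> * t))"
    if s: "0 \<le> s" "s \<le> t" for s
  proof -
    have "a * (t - s) \<le> \<bar>a\<bar> * t" "b * s \<le> \<bar>b\<bar> * t"
      using s by (auto intro!: mult_mono)
    then have "A * exp (a * (t - s)) \<le> A * exp (\<bar>a\<bar> * t)" "B * exp (b * s) \<le> B * exp (\<bar>b\<bar> * t)"
      using AB by (auto intro!: mult_left_mono)
    with exp_dominatedD(5)[OF F, of "t - s"] exp_dominatedD(5)[OF G, of s]
    show ?thesis
      unfolding abs_mult using AB by (intro mult_mono) auto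
  qed
  show ?thesis
  proof (rule Bochner_Integration.integrable_bound)
    show "integrable lborel
        (\<lambda>s. (A * exp (\<bar>a\<bar> * t)) * (B * exp (\<bar>b\<bar> * t)) * indicator {0..t} s)"
      using emeasure_lborel_Icc_eq[of 0 t]
      by (intro integrable_mult_right integrable_real_indicator) auto
    show "AE s in lborel. norm (F (t - s) * G s)
        \<le> norm ((A * exp (\<bar>a\<bar> * t)) * (B * exp (\<bar>b\<bar> * t)) * indicator {0..t} s)"
    proof (rule AE_I2)
      fix s
      show "norm (F (t - s) * G s)
        \<le> norm ((A * exp (\<bar>a\<bar> * t)) * (B * exp (\<bar>b\<bar> * t)) * indicator {0..t} s)"
        using *[of s] AB exp_dominatedD(2)[OF F, of "t - s"] exp_dominatedD(2)[OF G, of s]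
        by (cases "0 \<le> s \<and> s \<le> t") (auto simp: not_le abs_mult)
    qed
  qed measurable
qed

lemma convolve_commute: "F \<star> G = G \<star> F"
proof
  fix t
  have "(F \<star> G) t = (LINT s|lborel. F (t - (t + (-1) * s)) * G (t + (-1) * s))"
    unfolding convolve_def by (subst lborel_integral_real_affine[of "-1" _ t]) simp_all
  also have "\<dots> = (G \<star> F) t"
    unfolding convolve_def by (simp add: mult.commute)
  finally show "(F \<star> G) t = (G \<star> F) t" .
qed

lemma convolve_neg:
  assumes "\<And>t. t < 0 \<Longrightarrow> F t = 0" "\<And>t. t < 0 \<Longrightarrow> G t = 0" "t < 0"
  shows "(F \<star> G) t = 0"
proof -
  have "(\<lambda>s. F (t - s) * G s) = (\<lambda>s. 0)"
  proof
    fix s show "F (t - s) * G s = 0"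
      using assms by (cases "s < 0") auto
  qed
  then show ?thesis by (simp add: convolve_def)
qed

text \<open>Causality: the value at \<open>t\<close> only sees the factors on \<open>{0..t}\<close>.\<close>

lemma convolve_cong:
  assumes "\<And>t. t < 0 \<Longrightarrow> F t = 0" "\<And>t. t < 0 \<Longrightarrow> G t = 0" "\<And>t. t < 0 \<Longrightarrow> G' t = 0"
    and "\<And>s. 0 \<le> s \<Longrightarrow> s \<le> t \<Longrightarrow> G s = G' s"
  shows "(F \<star> G) t = (F \<star> G') t"
proof -
  have "(\<lambda>s. F (t - s) * G s) = (\<lambda>s. F (t - s) * G' s)"
  proof
    fix s show "F (t - s) * G s = F (t - s) * G' s"
      using assms by (cases "0 \<le> s \<and> s \<le> t") (auto simp: not_le)
  qed
  then show ?thesis by (simp add: convolve_def)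
qed

lemma convolve_0:
  assumes "\<And>t. t < 0 \<Longrightarrow> F t = 0" "\<And>t. t < 0 \<Longrightarrow> G t = 0"
  shows "(F \<star> G) 0 = 0"
proof -
  have "AE s in lborel. F (0 - s) * G s = 0"
    using AE_lborel_singleton[of "0::real"]
  proof eventually_elim
    case (elim s)
    then show ?case using assms by (cases "s < 0") auto
  qed
  then show ?thesis
    unfolding convolve_def by (rule integral_eq_zero_AE)
qed

lemma set_integral_eq_convolve:
  "(LINT s:{0..t}|lborel. f (t - s) * g s) = (causal f \<star> causal g) t"
  unfolding set_lebesgue_integral_def convolve_def
  by (rule Bochner_Integration.integral_cong) (auto simp: causal_def indicator_def)

lemma measurable_convolve:
  assumes [measurable]: "F \<in> borel_measurable borel" "G \<in> borel_measurable borel"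
  shows "F \<star> G \<in> borel_measurable borel"
proof -
  have "(\<lambda>t. LINT s|lborel. F (t - s) * G s) \<in> borel_measurable borel"
    by measurable
  then show ?thesis by (simp add: convolve_def[abs_def])
qed

text \<open>The gap \<open>b - a\<close> in the denominator is what makes a Volterra operator contractive in a
  sufficiently fast exponential weight.\<close>

lemma convolve_bound:
  assumes F: "exp_dominated a A F" and G: "exp_dominated b B G" and "a < b"
  shows "exp_dominated b (A * B / (b - a)) (F \<star> G)"
proof -
  have AB: "0 \<le> A" "0 \<le> B" using assms by (auto dest: exp_dominatedD(4))
  have "\<bar>(F \<star> G) t\<bar> \<le> A * B / (b - a) * exp (b * t)" for t
  proof -
    have int: "has_bochner_integral lborel
        (\<lambda>s. (A * B * exp (b * t)) * causal (\<lambda>s. exp (- ((b - a) * s))) s)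
        ((A * B * exp (b * t)) * (1 / (b - a)))"
      using \<open>a < b\<close> by (intro has_bochner_integral_mult_right has_integral_exp_neg_causal) auto
    have "\<bar>(F \<star> G) t\<bar> = \<bar>LINT s|lborel. G (t - s) * F s\<bar>"
      by (subst convolve_commute) (simp add: convolve_def)
    also have "\<dots> \<le> (LINT s|lborel. (A * B * exp (b * t)) * causal (\<lambda>s. exp (- ((b - a) * s))) s)"
    proof (subst real_norm_def[symmetric], rule Bochner_Integration.integral_norm_bound_integral)
      show "integrable lborel (\<lambda>s. G (t - s) * F s)"
        using G F by (rule integrable_convolution_integrand)
      show "integrable lborel
          (\<lambda>s. (A * B * exp (b * t)) * causal (\<lambda>s. exp (- ((b - a) * s))) s)"
        using int by (rule integrable.intros)
      fix s
      have "\<bar>G (t - s)\<bar> * \<bar>F s\<bar> \<le> (B * exp (b * (t - s))) * (A * exp (a * s))"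
        using exp_dominatedD(5)[OF G] exp_dominatedD(5)[OF F] AB by (intro mult_mono) auto
      also have "\<dots> = (A * B * exp (b * t)) * exp (- ((b - a) * s))"
      proof -
        have "exp (b * (t - s)) * exp (a * s) = exp (b * t) * exp (- ((b - a) * s))"
          unfolding exp_add[symmetric] by (simp add: algebra_simps)
        then show ?thesis by simp
      qed
      finally show "norm (G (t - s) * F s)
          \<le> (A * B * exp (b * t)) * causal (\<lambda>s. exp (- ((b - a) * s))) s"
        using exp_dominatedD(2)[OF F, of s] by (auto simp: causal_def abs_mult)
    qed
    also have "\<dots> = A * B / (b - a) * exp (b * t)"
      using has_bochner_integral_integral_eq[OF int] by simp
    finally show ?thesis .
  qed
  moreover have "(F \<star> G) t = 0" if "t < 0" for t
    using that exp_dominatedD(2)[OF F] exp_dominatedD(2)[OF G] by (intro convolve_neg) auto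
  moreover have "F \<star> G \<in> borel_measurable borel"
    using F G by (intro measurable_convolve) (auto dest: exp_dominatedD(1))
  ultimately show ?thesis by (auto simp: exp_dominated_def)
qed

lemma exp_dominated_convolve:
  assumes "exp_dominated a A F" "exp_dominated a B G"
  shows "exp_dominated (a + 1) (A * B) (F \<star> G)"
  using convolve_bound[OF assms(1) exp_dominated_mono[OF assms(2), of "a + 1" B]] by simp

lemma exp_boundedI: "exp_dominated a A F \<Longrightarrow> exp_bounded F"
  by (auto simp: exp_bounded_def)

lemma exp_boundedD:
  assumes "exp_bounded F"
  shows "F \<in> borel_measurable borel" "\<And>t. t < 0 \<Longrightarrow> F t = 0"
  using assms by (auto simp: exp_bounded_def exp_dominated_def)

lemma exp_bounded_obtain2:
  assumes "exp_bounded F" "exp_bounded G"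
  obtains a A B where "exp_dominated a A F" "exp_dominated a B G"
proof -
  from assms obtain a A b B where FG: "exp_dominated a A F" "exp_dominated b B G"
    by (auto simp: exp_bounded_def)
  show thesis
    by (rule that[of "max a b" A B]; rule exp_dominated_mono[OF FG(1)] exp_dominated_mono[OF FG(2)])
      auto
qed

lemma exp_bounded_add:
  assumes "exp_bounded F" "exp_bounded G"
  shows "exp_bounded (\<lambda>t. F t + G t)"
  using assms by (rule exp_bounded_obtain2) (rule exp_boundedI[OF exp_dominated_add])

lemma exp_bounded_uminus: "exp_bounded F \<Longrightarrow> exp_bounded (\<lambda>t. - F t)"
  by (auto simp: exp_bounded_def exp_dominated_def)

lemma exp_bounded_diff:
  assumes "exp_bounded F" "exp_bounded G"
  shows "exp_bounded (\<lambda>t. F t - G t)"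
  using exp_bounded_add[OF assms(1) exp_bounded_uminus[OF assms(2)]] by simp

lemma exp_bounded_sum: "(\<And>i. i \<in> I \<Longrightarrow> exp_bounded (F i)) \<Longrightarrow> exp_bounded (\<lambda>t. \<Sum>i\<in>I. F i t)"
proof (induction I rule: infinite_finite_induct)
  case (insert i I)
  then show ?case by (auto intro!: exp_bounded_add)
qed (auto simp: exp_dominated_def intro!: exp_boundedI[of 0 0])

lemma exp_bounded_convolve:
  assumes "exp_bounded F" "exp_bounded G"
  shows "exp_bounded (F \<star> G)"
  using assms by (rule exp_bounded_obtain2) (rule exp_boundedI[OF exp_dominated_convolve])

lemma exp_bounded_translate: "exp_bounded F \<Longrightarrow> 0 \<le> s \<Longrightarrow> exp_bounded (translate s F)"
  unfolding exp_bounded_def by (blast intro: exp_dominated_translate)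

lemma integrable_convolution:
  assumes "exp_bounded F" "exp_bounded G"
  shows "integrable lborel (\<lambda>s. F (t - s) * G s)"
  using assms by (auto simp: exp_bounded_def intro: integrable_convolution_integrand)

lemmas exp_bounded_intros = exp_bounded_add exp_bounded_diff exp_bounded_sum exp_bounded_convolve
  exp_bounded_translate

lemma convolve_add_right:
  assumes "exp_bounded F" "exp_bounded G" "exp_bounded H"
  shows "(F \<star> (\<lambda>t. G t + H t)) t = (F \<star> G) t + (F \<star> H) t"
  unfolding convolve_def distrib_left
  using assms by (intro Bochner_Integration.integral_add integrable_convolution)

lemma convolve_diff_right:
  assumes "exp_bounded F" "exp_bounded G" "exp_bounded H"
  shows "(F \<star> (\<lambda>t. G t - H t)) t = (F \<star> G) t - (F \<star> H) t"
  unfolding convolve_def right_diff_distrib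
  using assms by (intro Bochner_Integration.integral_diff integrable_convolution)

lemma convolve_sum_right:
  assumes "exp_bounded F" "\<And>i. i \<in> I \<Longrightarrow> exp_bounded (G i)"
  shows "(F \<star> (\<lambda>t. \<Sum>i\<in>I. G i t)) t = (\<Sum>i\<in>I. (F \<star> G i) t)"
  unfolding convolve_def sum_distrib_left
  using assms by (intro Bochner_Integration.integral_sum integrable_convolution)

lemma convolve_cmult_right: "(F \<star> (\<lambda>t. c * G t)) t = c * (F \<star> G) t"
  by (simp add: convolve_def mult.left_commute)

lemma convolve_sum_left:
  assumes "exp_bounded F" "\<And>i. i \<in> I \<Longrightarrow> exp_bounded (G i)"
  shows "((\<lambda>t. \<Sum>i\<in>I. G i t) \<star> F) t = (\<Sum>i\<in>I. (G i \<star> F) t)"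
  using convolve_sum_right[OF assms] by (simp add: convolve_commute[of _ F])

lemma convolve_add_left:
  assumes "exp_bounded F" "exp_bounded G" "exp_bounded H"
  shows "((\<lambda>t. G t + H t) \<star> F) t = (G \<star> F) t + (H \<star> F) t"
  using convolve_add_right[OF assms] by (simp add: convolve_commute[of _ F])

lemma convolve_diff_left:
  assumes "exp_bounded F" "exp_bounded G" "exp_bounded H"
  shows "((\<lambda>t. G t - H t) \<star> F) t = (G \<star> F) t - (H \<star> F) t"
  using convolve_diff_right[OF assms] by (simp add: convolve_commute[of _ F])

lemma convolve_cmult_left: "((\<lambda>t. c * G t) \<star> F) t = c * (G \<star> F) t"
  using convolve_cmult_right[of F c G t] by (simp add: convolve_commute[of _ F])

text \<open>After the shift \<open>x = y + u\<close> this is an exchange of integrals. Fubini applies because the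
  integrand is bounded and, by causality, vanishes off the square \<open>{0..t} \<times> {0..t}\<close>.\<close>

lemma convolve_assoc:
  assumes "exp_bounded F" and "exp_bounded G" and "exp_bounded H"
  shows "(F \<star> G) \<star> H = F \<star> (G \<star> H)"
proof
  fix t
  from assms obtain a A b B c C where F: "exp_dominated a A F" and G: "exp_dominated b B G"
    and H: "exp_dominated c C H" by (auto simp: exp_bounded_def)
  have [measurable]: "F \<in> borel_measurable borel" "G \<in> borel_measurable borel"
      "H \<in> borel_measurable borel"
    using F G H by (auto dest: exp_dominatedD(1))
  have ABC: "0 \<le> A" "0 \<le> B" "0 \<le> C" using F G H by (auto dest: exp_dominatedD(4))
  define K where "K = (A * exp (\<bar>a\<bar> * t)) * (B * exp (\<bar>b\<bar> * t)) * (C * exp (\<bar>c\<bar> * t))"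
  let ?f = "\<lambda>x y. F (t - x) * G (x - y) * H y"
  have K: "\<bar>?f x y\<bar> \<le> K" if xy: "0 \<le> y" "y \<le> x" "x \<le> t" for x y
  proof -
    have "a * (t - x) \<le> \<bar>a\<bar> * t" "b * (x - y) \<le> \<bar>b\<bar> * t" "c * y \<le> \<bar>c\<bar> * t"
      using xy by (auto intro!: mult_mono)
    then have "A * exp (a * (t - x)) \<le> A * exp (\<bar>a\<bar> * t)"
      "B * exp (b * (x - y)) \<le> B * exp (\<bar>b\<bar> * t)" "C * exp (c * y) \<le> C * exp (\<bar>c\<bar> * t)"
      using ABC by (auto intro!: mult_left_mono)
    with exp_dominatedD(5)[OF F, of "t - x"] exp_dominatedD(5)[OF G, of "x - y"]
      exp_dominatedD(5)[OF H, of y]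
    show ?thesis
      unfolding abs_mult K_def using ABC by (intro mult_mono) auto
  qed
  have "0 \<le> K" using ABC by (simp add: K_def)
  have "integrable (lborel \<Otimes>\<^sub>M lborel) (\<lambda>z. ?f (fst z) (snd z))"
  proof (rule Bochner_Integration.integrable_bound)
    have "emeasure (lborel \<Otimes>\<^sub>M lborel) ({0..t} \<times> {0..t}) < \<infinity>"
      by (subst lborel.emeasure_pair_measure_Times)
        (auto simp: emeasure_lborel_Icc_eq ennreal_mult_less_top)
    then show "integrable (lborel \<Otimes>\<^sub>M lborel) (\<lambda>z. K * indicator ({0..t} \<times> {0..t}) z)"
      by (intro integrable_mult_right integrable_real_indicator) auto
    show "AE z in lborel \<Otimes>\<^sub>M lborel. norm (?f (fst z) (snd z))
        \<le> norm (K * indicator ({0..t} \<times> {0..t}) z)"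
    proof (rule AE_I2)
      fix z :: "real \<times> real"
      show "norm (?f (fst z) (snd z)) \<le> norm (K * indicator ({0..t} \<times> {0..t}) z)"
      proof (cases "0 \<le> snd z \<and> snd z \<le> fst z \<and> fst z \<le> t")
        case True
        then have "z \<in> {0..t} \<times> {0..t}" by (cases z) auto
        with K[of "snd z" "fst z"] True \<open>0 \<le> K\<close> show ?thesis by simp
      next
        case False
        then have "?f (fst z) (snd z) = 0"
          using exp_dominatedD(2)[OF F] exp_dominatedD(2)[OF G] exp_dominatedD(2)[OF H]
          by (auto simp: not_le)
        then show ?thesis by (simp only:) simp
      qed
    qed
  qed measurable
  then have "integrable (lborel \<Otimes>\<^sub>M lborel) (case_prod ?f)"
    by (simp add: case_prod_beta')
  from lborel_pair.Fubini_integral[OF this]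
  have "(LINT y|lborel. LINT x|lborel. ?f x y) = (LINT x|lborel. LINT y|lborel. ?f x y)" .
  moreover have "(LINT x|lborel. LINT y|lborel. ?f x y) = (F \<star> (G \<star> H)) t"
    by (simp add: convolve_def mult.assoc)
  moreover have "(\<lambda>y. LINT x|lborel. ?f x y) = (\<lambda>y. (F \<star> G) (t - y) * H y)"
  proof
    fix y
    have "(LINT x|lborel. ?f x y) = (LINT x|lborel. F (t - (y + 1 * x)) * G (y + 1 * x - y) * H y)"
      by (subst lborel_integral_real_affine[of 1 _ y]) simp_all
    also have "\<dots> = (LINT x|lborel. (F (t - y - x) * G x) * H y)"
      by (simp add: algebra_simps)
    also have "\<dots> = (LINT x|lborel. F (t - y - x) * G x) * H y"
      by simp
    finally show "(LINT x|lborel. ?f x y) = (F \<star> G) (t - y) * H y"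
      by (simp add: convolve_def)
  qed
  ultimately show "(F \<star> G \<star> H) t = (F \<star> (G \<star> H)) t"
    by (simp add: convolve_def[of "F \<star> G" H])
qed

text \<open>Splitting the integral over \<open>{0..t+s}\<close> at \<open>s\<close>. This identity carries the semigroup law:
  the first term lets the past act, the second restarts the convolution at time \<open>s\<close>.\<close>

lemma convolve_plus:
  assumes F: "exp_bounded F" and G: "exp_bounded G" and ts: "0 \<le> t" "0 \<le> s"
  shows "(F \<star> G) (t + s) = (translate t F \<star> G) s + (F \<star> translate s G) t"
proof -
  let ?h = "\<lambda>u. F (t - u) * translate s G u"
  have F': "exp_bounded (translate t F)" and G': "exp_bounded (translate s G)"
    using F G ts by (auto intro: exp_bounded_translate)
  have int: "integrable lborel ?h"
    using F G' by (rule integrable_convolution)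
  then have int': "integrable lborel (\<lambda>u. ?h (- s + 1 * u))"
    by (rule lborel_integrable_real_affine) simp
  have "(F \<star> translate s G) t = (LINT u|lborel. ?h (- s + 1 * u))"
    unfolding convolve_def by (subst lborel_integral_real_affine[of 1 _ "- s"]) simp_all
  then have "(translate t F \<star> G) s + (F \<star> translate s G) t
      = (LINT u|lborel. translate t F (s - u) * G u + ?h (- s + 1 * u))"
    using int' integrable_convolution[OF F' G, of s]
    by (simp add: convolve_def)
  also have "\<dots> = (LINT u|lborel. F (t + s - u) * G u)"
  proof (rule integral_cong_AE)
    have [measurable]: "F \<in> borel_measurable borel" "G \<in> borel_measurable borel"
      "translate t F \<in> borel_measurable borel" "translate s G \<in> borel_measurable borel"
      using F G F' G' by (auto dest: exp_boundedD(1))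
    show "(\<lambda>u. translate t F (s - u) * G u + ?h (- s + 1 * u)) \<in> borel_measurable lborel"
      by measurable
    show "(\<lambda>u. F (t + s - u) * G u) \<in> borel_measurable lborel"
      by measurable
    show "AE u in lborel. translate t F (s - u) * G u + ?h (- s + 1 * u) = F (t + s - u) * G u"
      using AE_lborel_singleton[of s]
    proof eventually_elim
      case (elim u)
      then show ?case
        by (cases "u < s") (auto simp: translate_def causal_def algebra_simps)
    qed
  qed
  finally show ?thesis by (simp add: convolve_def)
qed

section \<open>Laplace transforms\<close>

definition laplace_integral :: "complex \<Rightarrow> (real \<Rightarrow> real) \<Rightarrow> complex" where
  "laplace_integral \<zeta> F = (LINT t|lborel. exp (- \<zeta> * of_real t) * of_real (F t))"

lemma integrable_laplace:
  assumes F: "exp_dominated a A F" and "a < Re \<zeta>"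
  shows "integrable lborel (\<lambda>t. exp (- \<zeta> * of_real t) * complex_of_real (F t))"
proof (rule Bochner_Integration.integrable_bound)
  have [measurable]: "F \<in> borel_measurable borel" by (rule exp_dominatedD[OF F])
  show "integrable lborel (\<lambda>t. A * causal (\<lambda>t. exp (- ((Re \<zeta> - a) * t))) t)"
    using integrable.intros[OF has_integral_exp_neg_causal[of "Re \<zeta> - a"]] assms
    by (intro integrable_mult_right) simp
  show "(\<lambda>t. exp (- \<zeta> * of_real t) * complex_of_real (F t)) \<in> borel_measurable lborel"
    by measurable
  show "AE t in lborel. norm (exp (- \<zeta> * of_real t) * complex_of_real (F t))
      \<le> norm (A * causal (\<lambda>t. exp (- ((Re \<zeta> - a) * t))) t)"
  proof (rule AE_I2)
    fix t
    have "exp (- (Re \<zeta> * t)) * \<bar>F t\<bar> \<le> exp (- (Re \<zeta> * t)) * (A * exp (a * t))"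
      using exp_dominatedD(5)[OF F] by (intro mult_left_mono) auto
    also have "\<dots> = A * exp (- ((Re \<zeta> - a) * t))"
    proof -
      have "exp (- (Re \<zeta> * t)) * exp (a * t) = exp (- ((Re \<zeta> - a) * t))"
        unfolding exp_add[symmetric] by (simp add: algebra_simps)
      then show ?thesis by (simp add: mult.left_commute)
    qed
    finally show "norm (exp (- \<zeta> * of_real t) * complex_of_real (F t))
      \<le> norm (A * causal (\<lambda>t. exp (- ((Re \<zeta> - a) * t))) t)"
      using exp_dominatedD(2)[OF F, of t] exp_dominatedD(4)[OF F]
      by (auto simp: causal_def norm_mult norm_exp_eq_Re)
  qed
qed

lemma laplace_integral_add:
  assumes "exp_dominated a A F" "exp_dominated b B G" "a < Re \<zeta>" "b < Re \<zeta>"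
  shows "laplace_integral \<zeta> (\<lambda>t. F t + G t) = laplace_integral \<zeta> F + laplace_integral \<zeta> G"
  unfolding laplace_integral_def of_real_add distrib_left
  using assms by (intro Bochner_Integration.integral_add integrable_laplace)

lemma laplace_integral_sum:
  assumes "\<And>i. i \<in> I \<Longrightarrow> exp_dominated a (A i) (F i)" "a < Re \<zeta>"
  shows "laplace_integral \<zeta> (\<lambda>t. \<Sum>i\<in>I. F i t) = (\<Sum>i\<in>I. laplace_integral \<zeta> (F i))"
  unfolding laplace_integral_def of_real_sum sum_distrib_left
  using assms by (intro Bochner_Integration.integral_sum integrable_laplace)

text \<open>\<open>exp (- \<zeta> * t)\<close> distributes over the two factors of the convolution, which makes them
  integrable; the double integral over the plane then separates.\<close>

lemma laplace_integral_convolve: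
  assumes F: "exp_dominated a A F" and G: "exp_dominated b B G" and "a < Re \<zeta>" "b < Re \<zeta>"
  shows "laplace_integral \<zeta> (F \<star> G) = laplace_integral \<zeta> F * laplace_integral \<zeta> G"
proof -
  define f where "f t = exp (- \<zeta> * of_real t) * complex_of_real (F t)" for t
  define g where "g t = exp (- \<zeta> * of_real t) * complex_of_real (G t)" for t
  have f: "integrable lborel f" and g: "integrable lborel g"
    using integrable_laplace[OF F] integrable_laplace[OF G] assms
    unfolding f_def[abs_def] g_def[abs_def] by auto
  note [measurable] = borel_measurable_integrable[OF f] borel_measurable_integrable[OF g]
  have f': "integrable lborel (\<lambda>t. f (t - s))" for s
    using lborel_integrable_real_affine[OF f, of 1 "- s"] by simp
  have shift: "(LINT t|lborel. h (t - s)) = (LINT t|lborel. h t)"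
    for h :: "real \<Rightarrow> 'z :: {banach, second_countable_topology}" and s :: real
    using lborel_integral_real_affine[of 1 h "- s"] by simp
  have int: "integrable (lborel \<Otimes>\<^sub>M lborel) (\<lambda>(s, t). f (t - s) * g s)"
  proof (rule lborel_pair.Fubini_integrable)
    show "(\<lambda>(s, t). f (t - s) * g s) \<in> borel_measurable (lborel \<Otimes>\<^sub>M lborel)"
      by measurable
    have "(LINT t|lborel. norm (f (t - s) * g s)) = (LINT t|lborel. norm (f t)) * norm (g s)" for s
      using shift[of "\<lambda>t. norm (f t)" s] by (simp add: norm_mult)
    then show "integrable lborel
        (\<lambda>s. LINT t|lborel. norm (case (s, t) of (s, t) \<Rightarrow> f (t - s) * g s))"
      using g by simp
    show "AE s in lborel. integrable lborel (\<lambda>t. case (s, t) of (s, t) \<Rightarrow> f (t - s) * g s)"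
      using f' by (intro AE_I2) simp
  qed
  have "exp (- \<zeta> * of_real t) * complex_of_real ((F \<star> G) t) = (LINT s|lborel. f (t - s) * g s)" for t
  proof -
    have "(LINT s|lborel. f (t - s) * g s)
        = (LINT s|lborel. exp (- \<zeta> * of_real t) * complex_of_real (F (t - s) * G s))"
    proof (intro Bochner_Integration.integral_cong refl)
      fix s
      have "exp (- \<zeta> * of_real (t - s)) * exp (- \<zeta> * of_real s) = exp (- \<zeta> * of_real t)"
        unfolding exp_add[symmetric] by (simp add: algebra_simps)
      then show "f (t - s) * g s = exp (- \<zeta> * of_real t) * complex_of_real (F (t - s) * G s)"
        unfolding f_def g_def of_real_mult by (metis mult.assoc mult.left_commute)
    qed
    also have "\<dots> = exp (- \<zeta> * of_real t) * complex_of_real ((F \<star> G) t)"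
      unfolding convolve_def
      by (simp only: integral_mult_right_zero integral_complex_of_real)
    finally show ?thesis by simp
  qed
  then have "laplace_integral \<zeta> (F \<star> G) = (LINT t|lborel. LINT s|lborel. f (t - s) * g s)"
    by (simp add: laplace_integral_def)
  also have "\<dots> = (LINT s|lborel. LINT t|lborel. f (t - s) * g s)"
    using lborel_pair.Fubini_integral[OF int] .
  also have "\<dots> = (LINT t|lborel. f t) * (LINT s|lborel. g s)"
    using shift[of f] by simp
  finally show ?thesis by (simp add: laplace_integral_def f_def[abs_def] g_def[abs_def])
qed

section \<open>Weak integrals against integrable weights\<close>

text \<open>An abstract family \<open>\<phi> t\<close> of functionals on \<open>'b\<close>, standing for an orbit of the
  unperturbed semigroup. Its Laplace integrals are represented by elements of \<open>'a\<close>; the aim is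
  to replace the exponentials by arbitrary measurable weights. The roles of \<open>'a\<close> and
  \<open>'b\<close> are abstract because the result is needed on both sides of the pairing.\<close>

locale laplace_representable =
  fixes p :: "'b::real_normed_vector \<Rightarrow> 'a::banach \<Rightarrow> real"
    and \<phi> :: "real \<Rightarrow> 'b \<Rightarrow> real" and C \<omega> :: real
  assumes bilinear: "bounded_bilinear p"
    and norm_le: "\<And>y \<epsilon>. 0 \<le> \<epsilon> \<Longrightarrow> (\<And>y'. \<bar>p y' y\<bar> \<le> \<epsilon> * norm y') \<Longrightarrow> norm y \<le> \<epsilon>"
    and dominated: "\<And>y'. exp_dominated \<omega> (C * norm y') (\<lambda>t. \<phi> t y')"
    and C_nonneg: "0 \<le> C"
    and laplace: "\<And>\<mu>. \<omega> < \<mu> \<Longrightarrow>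
      \<exists>z. \<forall>y'. p y' z = (LINT t|lborel. exp (- (\<mu> * t)) * \<phi> t y')"
begin

text \<open>Splitting off the factor \<open>exp (- (\<mu> * t))\<close> reduces the question to bounded weights, for
  which bounded pointwise limits are available.\<close>

definition representable_weight :: "real \<Rightarrow> (real \<Rightarrow> real) \<Rightarrow> bool" where
  "representable_weight \<mu> f \<longleftrightarrow>
     f \<in> borel_measurable borel \<and> (\<exists>B. \<forall>t\<ge>0. \<bar>f t\<bar> \<le> B) \<and>
     (\<exists>z. \<forall>y'. p y' z = (LINT t|lborel. exp (- (\<mu> * t)) * f t * \<phi> t y'))"

text \<open>Bounds \<open>\<bar>exp (- (\<mu> * t)) * \<phi> t y'\<bar>\<close> uniformly for \<open>y'\<close> in the unit ball.\<close>

definition majorant :: "real \<Rightarrow> real \<Rightarrow> real" where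
  "majorant \<mu> = (\<lambda>t. C * causal (\<lambda>t. exp (- ((\<mu> - \<omega>) * t))) t)"

lemma integrable_majorant: "\<omega> < \<mu> \<Longrightarrow> integrable lborel (majorant \<mu>)"
  unfolding majorant_def
  using integrable.intros[OF has_integral_exp_neg_causal[of "\<mu> - \<omega>"]]
  by (intro integrable_mult_right) simp

lemma majorant_nonneg: "0 \<le> majorant \<mu> t"
  using C_nonneg by (simp add: majorant_def causal_def)

lemma majorant_neg: "t < 0 \<Longrightarrow> majorant \<mu> t = 0"
  by (simp add: majorant_def)

lemma majorant_bound: "\<bar>exp (- (\<mu> * t)) * x * \<phi> t y'\<bar> \<le> majorant \<mu> t * \<bar>x\<bar> * norm y'"
proof (cases "0 \<le> t")
  case True
  have "exp (- (\<mu> * t)) * \<bar>\<phi> t y'\<bar> \<le> exp (- (\<mu> * t)) * (C * norm y' * exp (\<omega> * t))"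
    using exp_dominatedD(5)[OF dominated] by (intro mult_left_mono) auto
  also have "\<dots> = C * exp (- (\<mu> * t) + \<omega> * t) * norm y'"
    unfolding exp_add by simp
  also have "- (\<mu> * t) + \<omega> * t = - ((\<mu> - \<omega>) * t)"
    by (simp add: algebra_simps)
  finally have "exp (- (\<mu> * t)) * \<bar>\<phi> t y'\<bar> * \<bar>x\<bar> \<le> majorant \<mu> t * norm y' * \<bar>x\<bar>"
    using True by (intro mult_right_mono) (auto simp: majorant_def)
  then show ?thesis by (simp add: abs_mult mult.assoc mult.left_commute mult.commute)
next
  case False
  then show ?thesis using exp_dominatedD(2)[OF dominated, of t] by (simp add: majorant_neg)
qed

lemma measurable_phi [measurable]: "(\<lambda>t. \<phi> t y') \<in> borel_measurable borel"
  by (rule exp_dominatedD[OF dominated])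

lemma measurable_majorant [measurable]: "majorant \<mu> \<in> borel_measurable borel"
proof -
  have "causal (\<lambda>t. exp (- ((\<mu> - \<omega>) * t))) \<in> borel_measurable borel"
    by (rule measurable_causal) (simp add: measurable_restrict_space1)
  then show ?thesis by (simp add: majorant_def)
qed

lemma integrable_majorant_times:
  assumes [measurable]: "f \<in> borel_measurable borel" and B: "\<And>t. 0 \<le> t \<Longrightarrow> \<bar>f t\<bar> \<le> B"
    and "\<omega> < \<mu>"
  shows "integrable lborel (\<lambda>t. majorant \<mu> t * \<bar>f t\<bar>)"
proof (rule Bochner_Integration.integrable_bound)
  show "integrable lborel (\<lambda>t. majorant \<mu> t * B)"
    using integrable_majorant[OF \<open>\<omega> < \<mu>\<close>] by simp
  show "AE t in lborel. norm (majorant \<mu> t * \<bar>f t\<bar>) \<le> norm (majorant \<mu> t * B)"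
  proof (rule AE_I2)
    fix t
    show "norm (majorant \<mu> t * \<bar>f t\<bar>) \<le> norm (majorant \<mu> t * B)"
      using B[of t] majorant_neg[of t \<mu>]
      by (cases "0 \<le> t") (auto simp: abs_mult intro!: mult_left_mono)
  qed
qed measurable

lemma integrable_weighted:
  assumes [measurable]: "f \<in> borel_measurable borel" and B: "\<And>t. 0 \<le> t \<Longrightarrow> \<bar>f t\<bar> \<le> B"
    and "\<omega> < \<mu>"
  shows "integrable lborel (\<lambda>t. exp (- (\<mu> * t)) * f t * \<phi> t y')"
proof (rule Bochner_Integration.integrable_bound)
  show "integrable lborel (\<lambda>t. majorant \<mu> t * \<bar>f t\<bar> * norm y')"
    using integrable_majorant_times[OF assms] by simp
  show "AE t in lborel. norm (exp (- (\<mu> * t)) * f t * \<phi> t y')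
      \<le> norm (majorant \<mu> t * \<bar>f t\<bar> * norm y')"
    using majorant_bound[of \<mu>] majorant_nonneg[of \<mu>] by (intro AE_I2) (simp add: abs_mult)
qed measurable

lemma representable_weight_add:
  assumes "\<omega> < \<mu>" "representable_weight \<mu> f" "representable_weight \<mu> g"
  shows "representable_weight \<mu> (\<lambda>t. f t + g t)"
proof -
  from assms obtain A B z w
    where fg [measurable]: "f \<in> borel_measurable borel" "g \<in> borel_measurable borel"
      and A: "\<And>t. 0 \<le> t \<Longrightarrow> \<bar>f t\<bar> \<le> A" and B: "\<And>t. 0 \<le> t \<Longrightarrow> \<bar>g t\<bar> \<le> B"
      and z: "\<And>y'. p y' z = (LINT t|lborel. exp (- (\<mu> * t)) * f t * \<phi> t y')"
      and w: "\<And>y'. p y' w = (LINT t|lborel. exp (- (\<mu> * t)) * g t * \<phi> t y')"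
    unfolding representable_weight_def by metis
  have "p y' (z + w) = (LINT t|lborel. exp (- (\<mu> * t)) * (f t + g t) * \<phi> t y')" for y'
    using integrable_weighted[OF fg(1) A \<open>\<omega> < \<mu>\<close>] integrable_weighted[OF fg(2) B \<open>\<omega> < \<mu>\<close>]
    by (simp add: bounded_bilinear.add_right[OF bilinear] z w distrib_left distrib_right)
  moreover have "\<bar>f t + g t\<bar> \<le> A + B" if "0 \<le> t" for t
    using A[OF that] B[OF that] by simp
  ultimately show ?thesis
    unfolding representable_weight_def by (intro conjI exI allI impI) auto
qed

lemma representable_weight_cmult:
  assumes "representable_weight \<mu> f"
  shows "representable_weight \<mu> (\<lambda>t. c * f t)"
proof -
  from assms obtain A z
    where f [measurable]: "f \<in> borel_measurable borel"
      and A: "\<And>t. 0 \<le> t \<Longrightarrow> \<bar>f t\<bar> \<le> A"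
      and z: "\<And>y'. p y' z = (LINT t|lborel. exp (- (\<mu> * t)) * f t * \<phi> t y')"
    unfolding representable_weight_def by metis
  have "p y' (c *\<^sub>R z) = (LINT t|lborel. exp (- (\<mu> * t)) * (c * f t) * \<phi> t y')" for y'
    using integral_mult_right_zero[of lborel c "\<lambda>t. exp (- (\<mu> * t)) * f t * \<phi> t y'"]
    by (simp add: bounded_bilinear.scaleR_right[OF bilinear] z ac_simps)
  moreover have "\<bar>c * f t\<bar> \<le> \<bar>c\<bar> * A" if "0 \<le> t" for t
    using A[OF that] by (simp add: abs_mult mult_left_mono)
  ultimately show ?thesis
    unfolding representable_weight_def by (intro conjI exI allI impI) auto
qed

lemma representable_weight_diff:
  assumes "\<omega> < \<mu>" "representable_weight \<mu> f" "representable_weight \<mu> g"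
  shows "representable_weight \<mu> (\<lambda>t. f t - g t)"
  using representable_weight_add[OF assms(1,2) representable_weight_cmult[OF assms(3), of "-1"]]
  by simp

lemma representable_weight_exp:
  assumes "\<omega> < \<mu>"
  shows "representable_weight \<mu> (\<lambda>t. exp (- t) ^ n)"
proof -
  have "\<omega> < \<mu> + real n" using assms by simp
  from laplace[OF this] obtain z
    where z: "\<And>y'. p y' z = (LINT t|lborel. exp (- ((\<mu> + real n) * t)) * \<phi> t y')" by blast
  have "exp (- ((\<mu> + real n) * t)) = exp (- (\<mu> * t)) * exp (- t) ^ n" for t
    by (simp add: exp_of_nat_mult[symmetric] exp_add[symmetric] algebra_simps)
  moreover have "\<bar>exp (- t) ^ n\<bar> \<le> 1" if "0 \<le> t" for t :: real
    using that by (simp add: power_le_one)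
  ultimately show ?thesis
    unfolding representable_weight_def using z by (intro conjI exI allI impI) auto
qed

lemma representable_weight_sum:
  assumes "\<omega> < \<mu>" "\<And>i. i \<in> I \<Longrightarrow> representable_weight \<mu> (f i)"
  shows "representable_weight \<mu> (\<lambda>t. \<Sum>i\<in>I. f i t)"
proof -
  have zero: "representable_weight \<mu> (\<lambda>t. 0)"
    using representable_weight_cmult[OF representable_weight_exp[OF assms(1), of 0], of 0] by simp
  show ?thesis
    using assms(2) by (induction I rule: infinite_finite_induct)
      (auto intro!: representable_weight_add[OF assms(1)] zero)
qed

text \<open>Because the norm of \<open>'a\<close> is the dual norm, weak integrals converge in norm as soon as
  their weights converge in the weighted \<open>L\<^sup>1\<close> space; completeness of \<open>'a\<close> then supplies the
  representing element.\<close>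

lemma representable_weight_limit:
  assumes "\<omega> < \<mu>" and F: "\<And>n. representable_weight \<mu> (F n)"
    and B: "\<And>n t. 0 \<le> t \<Longrightarrow> \<bar>F n t\<bar> \<le> B"
    and f [measurable]: "f \<in> borel_measurable borel"
    and lim: "\<And>t. 0 \<le> t \<Longrightarrow> (\<lambda>n. F n t) \<longlonglongrightarrow> f t"
  shows "representable_weight \<mu> f"
proof -
  let ?I = "\<lambda>f y'. LINT t|lborel. exp (- (\<mu> * t)) * f t * \<phi> t y'"
  from F have Fm [measurable]: "F n \<in> borel_measurable borel" for n
    by (simp add: representable_weight_def)
  from F have "\<forall>n. \<exists>z. \<forall>y'. p y' z = ?I (F n) y'" by (simp add: representable_weight_def)
  then obtain z where z: "\<And>n y'. p y' (z n) = ?I (F n) y'" by metis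
  have fB: "\<bar>f t\<bar> \<le> B" if "0 \<le> t" for t
    using B[OF that] by (intro LIMSEQ_le_const2[OF tendsto_rabs[OF lim[OF that]]]) auto
  have dB: "\<bar>F n t - f t\<bar> \<le> 2 * B" if "0 \<le> t" for n t
    using B[OF that, of n] fB[OF that] by linarith
  \<comment> \<open>The weighted $L^1$ distance, which controls the distance of the representing elements.\<close>
  define \<epsilon> where "\<epsilon> n = (LINT t|lborel. majorant \<mu> t * \<bar>F n t - f t\<bar>)" for n
  have \<epsilon>0: "0 \<le> \<epsilon> n" for n
    unfolding \<epsilon>_def by (intro Bochner_Integration.integral_nonneg) (simp add: majorant_nonneg)
  have "\<epsilon> \<longlonglongrightarrow> integral\<^sup>L lborel (\<lambda>t::real. 0::real)"
    unfolding \<epsilon>_def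
  proof (rule integral_dominated_convergence[where w = "\<lambda>t. majorant \<mu> t * (2 * B)"])
    show "integrable lborel (\<lambda>t. majorant \<mu> t * (2 * B))"
      using integrable_majorant[OF \<open>\<omega> < \<mu>\<close>] by simp
    show "AE t in lborel. (\<lambda>n. majorant \<mu> t * \<bar>F n t - f t\<bar>) \<longlonglongrightarrow> 0"
    proof (rule AE_I2)
      fix t
      show "(\<lambda>n. majorant \<mu> t * \<bar>F n t - f t\<bar>) \<longlonglongrightarrow> 0"
      proof (cases "0 \<le> t")
        case True
        then have "(\<lambda>n. majorant \<mu> t * \<bar>F n t - f t\<bar>) \<longlonglongrightarrow> majorant \<mu> t * \<bar>f t - f t\<bar>"
          by (intro tendsto_intros lim)
        then show ?thesis by simp
      qed (simp add: majorant_neg)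
    qed
    fix n
    show "AE t in lborel. norm (majorant \<mu> t * \<bar>F n t - f t\<bar>) \<le> majorant \<mu> t * (2 * B)"
    proof (rule AE_I2)
      fix t
      show "norm (majorant \<mu> t * \<bar>F n t - f t\<bar>) \<le> majorant \<mu> t * (2 * B)"
        using dB[of t n] majorant_neg[of t \<mu>] majorant_nonneg[of \<mu> t]
        by (cases "0 \<le> t") (auto simp: abs_mult intro!: mult_left_mono)
    qed
  qed measurable
  then have \<epsilon>_lim: "\<epsilon> \<longlonglongrightarrow> 0" by simp
  have close: "\<bar>p y' (z n) - ?I f y'\<bar> \<le> \<epsilon> n * norm y'" for n y'
  proof -
    have "p y' (z n) - ?I f y' = (LINT t|lborel. exp (- (\<mu> * t)) * (F n t - f t) * \<phi> t y')"
      using integrable_weighted[OF Fm B \<open>\<omega> < \<mu>\<close>] integrable_weighted[OF f fB \<open>\<omega> < \<mu>\<close>]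
      by (simp add: z left_diff_distrib right_diff_distrib)
    also have "norm \<dots> \<le> (LINT t|lborel. majorant \<mu> t * \<bar>F n t - f t\<bar> * norm y')"
      using integrable_majorant_times[OF _ dB \<open>\<omega> < \<mu>\<close>] integrable_weighted[OF _ dB \<open>\<omega> < \<mu>\<close>]
        majorant_bound[of \<mu>]
      by (intro Bochner_Integration.integral_norm_bound_integral) auto
    also have "\<dots> = \<epsilon> n * norm y'" by (simp add: \<epsilon>_def)
    finally show ?thesis by simp
  qed
  have "norm (z m - z n) \<le> \<epsilon> m + \<epsilon> n" for m n
  proof (rule norm_le)
    fix y'
    show "\<bar>p y' (z m - z n)\<bar> \<le> (\<epsilon> m + \<epsilon> n) * norm y'"
      using close[of y' m] close[of y' n]
      by (simp add: bounded_bilinear.diff_right[OF bilinear] distrib_right)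
  qed (use \<epsilon>0 in simp)
  note zz = this
  have "Cauchy z"
  proof (rule CauchyI)
    fix e :: real assume "0 < e"
    with \<epsilon>_lim have "eventually (\<lambda>n. \<epsilon> n < e / 2) sequentially"
      by (intro order_tendstoD) auto
    then obtain N where N: "\<And>n. N \<le> n \<Longrightarrow> \<epsilon> n < e / 2" by (auto simp: eventually_sequentially)
    have "norm (z m - z n) < e" if "N \<le> m" "N \<le> n" for m n
      using zz[of m n] N[OF that(1)] N[OF that(2)] by linarith
    then show "\<exists>N. \<forall>m\<ge>N. \<forall>n\<ge>N. norm (z m - z n) < e" by blast
  qed
  then obtain z' where z': "z \<longlonglongrightarrow> z'" by (auto simp: Cauchy_convergent_iff convergent_def)
  have "p y' z' = ?I f y'" for y'
  proof (rule LIMSEQ_unique)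
    show "(\<lambda>n. p y' (z n)) \<longlonglongrightarrow> p y' z'"
      by (intro bounded_linear.tendsto[OF bounded_bilinear.bounded_linear_right[OF bilinear]] z')
    have "(\<lambda>n. \<epsilon> n * norm y') \<longlonglongrightarrow> 0"
      using tendsto_mult_right[OF \<epsilon>_lim, of "norm y'"] by simp
    then have "(\<lambda>n. p y' (z n) - ?I f y') \<longlonglongrightarrow> 0"
      by (rule Lim_null_comparison[rotated]) (use close in auto)
    then show "(\<lambda>n. p y' (z n)) \<longlonglongrightarrow> ?I f y'" by (simp add: LIM_zero_iff)
  qed
  then show ?thesis
    unfolding representable_weight_def using fB f by (intro conjI exI allI impI) auto
qed

text \<open>In the variable \<open>exp (- t)\<close> the exponentials \<open>exp (- n * t)\<close> are the monomials, so
  Bernstein polynomials and hence, by Weierstrass, all continuous functions of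
  \<open>exp (- t)\<close> are covered.\<close>

lemma representable_weight_Bernstein:
  assumes "\<omega> < \<mu>"
  shows "representable_weight \<mu> (\<lambda>t. exp (- t) ^ k * (1 - exp (- t)) ^ m)"
proof (induction m arbitrary: k)
  case 0
  then show ?case using representable_weight_exp[OF assms] by simp
next
  case (Suc m)
  have "(\<lambda>t. exp (- t) ^ k * (1 - exp (- t)) ^ Suc m)
      = (\<lambda>t. exp (- t) ^ k * (1 - exp (- t)) ^ m - exp (- t) ^ Suc k * (1 - exp (- t)) ^ m :: real)"
    by (auto simp: algebra_simps)
  then show ?case
    using representable_weight_diff[OF assms Suc Suc[of "Suc k"]] by simp
qed

lemma representable_weight_continuous:
  assumes "\<omega> < \<mu>" and f: "continuous_on UNIV (f :: real \<Rightarrow> real)"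
  shows "representable_weight \<mu> (\<lambda>t. f (exp (- t)))"
proof -
  define P where "P n x = (\<Sum>k\<le>n. f (k / n) * Bernstein n k x)" for n x
  have cont: "continuous_on {0..1} f" using f by (rule continuous_on_subset) simp
  have unif: "\<exists>N. \<forall>n x. N \<le> n \<and> x \<in> {0..1} \<longrightarrow> \<bar>f x - P n x\<bar> < e" if "0 < e" for e
    using Bernstein_Weierstrass[OF cont that] by (simp add: P_def)
  \<comment> \<open>From the index \<open>N\<close> on the approximants are uniformly bounded, as the limit lemma demands.\<close>
  from unif[of 1] obtain N where N: "\<And>n x. N \<le> n \<Longrightarrow> x \<in> {0..1} \<Longrightarrow> \<bar>f x - P n x\<bar> < 1" by auto
  have "bounded (f ` {0..1})"
    using compact_continuous_image compact_imp_bounded cont by blast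
  then obtain B where B: "\<And>x. x \<in> {0..1} \<Longrightarrow> \<bar>f x\<bar> \<le> B" by (force simp: bounded_iff)
  show ?thesis
  proof (rule representable_weight_limit[OF \<open>\<omega> < \<mu>\<close>])
    fix n
    show "representable_weight \<mu> (\<lambda>t. P (n + N) (exp (- t)))"
      unfolding P_def Bernstein_def mult.assoc
      by (intro representable_weight_sum[OF \<open>\<omega> < \<mu>\<close>] representable_weight_cmult
          representable_weight_Bernstein[OF \<open>\<omega> < \<mu>\<close>])
  next
    fix n and t :: real assume "0 \<le> t"
    then have "exp (- t) \<in> {0..1}" by simp
    from N[OF _ this, of "n + N"] B[OF this] show "\<bar>P (n + N) (exp (- t))\<bar> \<le> B + 1"
      by simp
  next
    show "(\<lambda>t. f (exp (- t))) \<in> borel_measurable borel"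
      using borel_measurable_continuous_onI[OF f] by measurable
  next
    fix t :: real assume "0 \<le> t"
    then have t: "exp (- t) \<in> {0..1}" by simp
    have "(\<lambda>n. P n (exp (- t))) \<longlonglongrightarrow> f (exp (- t))"
    proof (rule LIMSEQ_I)
      fix e :: real assume "0 < e"
      from unif[OF this] t show "\<exists>no. \<forall>n\<ge>no. norm (P n (exp (- t)) - f (exp (- t))) < e"
        unfolding real_norm_def abs_minus_commute[of "P _ _"] by meson
    qed
    then show "(\<lambda>n. P (n + N) (exp (- t))) \<longlonglongrightarrow> f (exp (- t))"
      by (rule LIMSEQ_ignore_initial_segment)
  qed
qed

lemma representable_weight_one: "\<omega> < \<mu> \<Longrightarrow> representable_weight \<mu> (\<lambda>t. 1)"
  using representable_weight_exp[of \<mu> 0] by simp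

text \<open>The half lines \<open>{..<b}\<close> generate the Borel sets and are stable under intersection, and
  the weights that can be represented form a Dynkin system.\<close>

lemma representable_weight_indicator:
  assumes "\<omega> < \<mu>" and "A \<in> sets borel"
  shows "representable_weight \<mu> (indicator A)"
proof -
  have A: "A \<in> sigma_sets UNIV (range lessThan)"
    using assms(2) by (simp add: borel_Iio[where 'a=real])
  have stable: "Int_stable (range lessThan :: real set set)"
  proof (rule Int_stableI_image)
    fix a b :: real
    have "{..<a} \<inter> {..<b} = {..<min a b}" by auto
    then show "\<exists>c\<in>UNIV. {..<a} \<inter> {..<b} = {..<c}" by blast
  qed
  have "range lessThan \<subseteq> Pow (UNIV :: real set)" by simp
  from stable this A show ?thesis
  proof (induction rule: sigma_sets_induct_disjoint)
    case (basic A)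
    then obtain b where A: "A = {..<b}" by auto
    \<comment> \<open>As functions of \<open>exp (- t)\<close> these increase to the indicator of \<open>t < b\<close>.\<close>
    define g where "g n x = min 1 (max 0 (real n * (x - exp (- b))))" for n x
    show ?case
    proof (rule representable_weight_limit[OF \<open>\<omega> < \<mu>\<close>])
      show "representable_weight \<mu> (\<lambda>t. g n (exp (- t)))" for n
        unfolding g_def
        by (rule representable_weight_continuous[OF \<open>\<omega> < \<mu>\<close>]) (intro continuous_intros)
      show "\<bar>g n (exp (- t))\<bar> \<le> 1" for n t by (auto simp: g_def)
      show "indicator A \<in> borel_measurable borel" by (simp add: A)
      fix t :: real
      show "(\<lambda>n. g n (exp (- t))) \<longlonglongrightarrow> indicator A t"
      proof (cases "t < b")
        case True
        then have d: "0 < exp (- t) - exp (- b)" by simp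
        obtain N where "1 / (exp (- t) - exp (- b)) < real N"
          using reals_Archimedean2 by blast
        then have N: "1 < real N * (exp (- t) - exp (- b))"
          using d by (simp add: divide_simps)
        have "g n (exp (- t)) = 1" if "N \<le> n" for n
        proof -
          have "real N * (exp (- t) - exp (- b)) \<le> real n * (exp (- t) - exp (- b))"
            using that d by (intro mult_right_mono) auto
          with N show ?thesis by (simp add: g_def)
        qed
        then have "eventually (\<lambda>n. g n (exp (- t)) = 1) sequentially"
          by (auto simp: eventually_sequentially)
        then show ?thesis using True by (simp add: A tendsto_eventually)
      next
        case False
        then have "real n * (exp (- t) - exp (- b)) \<le> 0" for n
          by (intro mult_nonneg_nonpos) auto
        then have "g n (exp (- t)) = 0" for n by (simp add: g_def max_absorb1)
        then show ?thesis using False by (simp add: A)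
      qed
    qed
  next
    case empty
    then show ?case
      using representable_weight_cmult[OF representable_weight_one[OF \<open>\<omega> < \<mu>\<close>], of 0] by simp
  next
    case (compl A)
    have "indicator (UNIV - A) = (\<lambda>t. 1 - indicator A t :: real)"
      by (auto simp: indicator_def)
    then show ?case
      using representable_weight_diff[OF \<open>\<omega> < \<mu>\<close> representable_weight_one[OF \<open>\<omega> < \<mu>\<close>] compl(2)]
      by simp
  next
    case (union A)
    show ?case
    proof (rule representable_weight_limit[OF \<open>\<omega> < \<mu>\<close>])
      have disj: "indicator (\<Union>i<n. A i) t = (\<Sum>i<n. indicator (A i) t :: real)" for n t
        using union(1) by (intro indicator_UN_disjoint) (auto intro: disjoint_family_on_mono)
      show "representable_weight \<mu> (\<lambda>t. \<Sum>i<n. indicator (A i) t)" for n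
        using union(3) by (intro representable_weight_sum[OF \<open>\<omega> < \<mu>\<close>])
      show "\<bar>\<Sum>i<n. indicator (A i) t :: real\<bar> \<le> 1" for n t
        unfolding disj[symmetric] by (simp add: indicator_def)
      have "range A \<subseteq> sets borel" using union(2) by (simp add: borel_Iio[where 'a=real])
      then show "indicator (\<Union>i. A i) \<in> borel_measurable borel" by (auto)
      show "(\<lambda>n. \<Sum>i<n. indicator (A i) t :: real) \<longlonglongrightarrow> indicator (\<Union>i. A i) t" for t
        unfolding disj[symmetric] by (rule LIMSEQ_indicator_UN)
    qed
  qed
qed

lemma representable_weight_nonneg:
  assumes "\<omega> < \<mu>" and "f \<in> borel_measurable borel" "\<And>t. 0 \<le> f t" "\<exists>B. \<forall>t. f t \<le> B"
  shows "representable_weight \<mu> f"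
  using assms(2-)
proof (induction rule: borel_measurable_induct_real)
  case (set A)
  then show ?case using representable_weight_indicator[OF \<open>\<omega> < \<mu>\<close>] by simp
next
  case (mult u c)
  show ?case
  proof (cases "c = 0")
    case True
    then show ?thesis
      using representable_weight_cmult[OF representable_weight_one[OF \<open>\<omega> < \<mu>\<close>], of 0] by simp
  next
    case False
    from mult.prems obtain B where "\<And>t. c * u t \<le> B" by auto
    then have "u t \<le> B / c" for t using False mult.hyps(1) by (simp add: field_simps)
    with mult.IH have "representable_weight \<mu> u" by auto
    then show ?thesis by (rule representable_weight_cmult)
  qed
next
  case (add u v)
  from add.prems obtain B where B: "\<And>t. v t + u t \<le> B" by auto
  have "0 \<le> u t" "0 \<le> v t" for t using add.hyps by auto
  then have "u t \<le> B" "v t \<le> B" for t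
    using B[of t] by (smt (verit))+
  then show ?case
    using add.IH by (intro representable_weight_add[OF \<open>\<omega> < \<mu>\<close>]) auto
next
  case (seq U)
  from seq.prems obtain B where B: "\<And>t. f t \<le> B" by auto
  have le: "U n t \<le> B" for n t
  proof -
    have "U n t \<le> f t"
    proof (rule incseq_le)
      show "incseq (\<lambda>n. U n t)" using seq.hyps(3) by (auto simp: incseq_def le_fun_def)
      show "(\<lambda>n. U n t) \<longlonglongrightarrow> f t" using seq.hyps(4) by simp
    qed
    with B[of t] show ?thesis by simp
  qed
  show ?case
  proof (rule representable_weight_limit[OF \<open>\<omega> < \<mu>\<close>])
    show "representable_weight \<mu> (U n)" for n using seq.IH[of n] le[of n] by (meson exI allI)
    show "\<bar>U n t\<bar> \<le> B" for n t using le[of n t] seq.hyps(2)[of n t] by simp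
    show "f \<in> borel_measurable borel"
      by (rule assms(2))
    show "(\<lambda>n. U n t) \<longlonglongrightarrow> f t" for t using seq.hyps(4) by simp
  qed
qed

theorem weak_integral_representable:
  assumes f [measurable]: "f \<in> borel_measurable borel"
    and B: "\<And>t. 0 \<le> t \<Longrightarrow> \<bar>f t\<bar> \<le> B * exp (- (\<mu> * t))" and "\<omega> < \<mu>"
  shows "\<exists>z. \<forall>y'. p y' z = (LINT t|lborel. f t * \<phi> t y')"
proof -
  define g where "g t = (if 0 \<le> t then exp (\<mu> * t) * f t else 0)" for t
  have [measurable]: "g \<in> borel_measurable borel" unfolding g_def[abs_def] by measurable
  have "0 \<le> B" using B[of 0] by simp
  have gB: "\<bar>g t\<bar> \<le> B" for t
  proof (cases "0 \<le> t")
    case True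
    then have "\<bar>g t\<bar> \<le> exp (\<mu> * t) * (B * exp (- (\<mu> * t)))"
      using B[OF True] by (simp add: g_def abs_mult)
    also have "\<dots> = B" by (simp add: exp_minus)
    finally show ?thesis .
  qed (use \<open>0 \<le> B\<close> in \<open>simp add: g_def\<close>)
  \<comment> \<open>Adding the constant \<open>B\<close> makes the weight nonnegative.\<close>
  have "representable_weight \<mu> (\<lambda>t. g t + B)"
  proof (rule representable_weight_nonneg[OF \<open>\<omega> < \<mu>\<close>])
    show "0 \<le> g t + B" for t using gB[of t] by linarith
    show "\<exists>B'. \<forall>t. g t + B \<le> B'"
      using gB by (intro exI[of _ "2 * B"]) (smt (verit))
  qed measurable
  moreover have "representable_weight \<mu> (\<lambda>t. B)"
    using representable_weight_cmult[OF representable_weight_one[OF \<open>\<omega> < \<mu>\<close>], of B] by simp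
  ultimately have "representable_weight \<mu> (\<lambda>t. g t + B - B)"
    by (rule representable_weight_diff[OF \<open>\<omega> < \<mu>\<close>])
  then have "representable_weight \<mu> g" by simp
  then obtain z where z: "\<And>y'. p y' z = (LINT t|lborel. exp (- (\<mu> * t)) * g t * \<phi> t y')"
    by (auto simp: representable_weight_def)
  have "exp (- (\<mu> * t)) * g t * \<phi> t y' = f t * \<phi> t y'" for t y'
    using exp_dominatedD(2)[OF dominated, of t y'] by (simp add: g_def exp_minus)
  with z show ?thesis by auto
qed

end

section \<open>Norming dual pairs\<close>

lemma norming_dual_pair_flip:
  assumes "norming_dual_pair p"
  shows "norming_dual_pair (\<lambda>y y'. p y' y)"
proof -
  from assms obtain M where "1 \<le> M" and M: "\<And>y' y. \<bar>p y' y\<bar> \<le> M * norm y' * norm y"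
    unfolding norming_dual_pair_def by blast
  have "\<bar>p y' y\<bar> \<le> M * norm y * norm y'" for y' y
    using M[of y' y] by (simp only: mult.assoc mult.commute[of "norm y"])
  with assms \<open>1 \<le> M\<close> show ?thesis
    unfolding norming_dual_pair_def bilinear_def by blast
qed

lemma norming_bounded_bilinear:
  assumes "norming_dual_pair p"
  shows "bounded_bilinear p"
proof -
  from assms obtain M where M: "\<And>y' y. \<bar>p y' y\<bar> \<le> M * norm y' * norm y" and p: "bilinear p"
    unfolding norming_dual_pair_def by blast
  show ?thesis
  proof (rule bounded_bilinear.intro)
    show "\<exists>K. \<forall>a b. norm (p a b) \<le> norm a * norm b * K"
      using M by (intro exI[of _ M]) (simp add: ac_simps)
  qed (simp_all add: bilinear_ladd[OF p] bilinear_radd[OF p] bilinear_lmul[OF p] bilinear_rmul[OF p])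
qed

text \<open>The norm of \<open>'a\<close> is recovered from the pairing, so that estimates of functionals become
  estimates of vectors.\<close>

lemma norming_norm_le:
  assumes p: "norming_dual_pair p" and "0 \<le> \<epsilon>" and le: "\<And>y'. \<bar>p y' y\<bar> \<le> \<epsilon> * norm y'"
  shows "norm y \<le> \<epsilon>"
proof -
  have "norm y = (SUP y'\<in>{y'. norm y' \<le> 1}. \<bar>p y' y\<bar>)"
    using p unfolding norming_dual_pair_def by blast
  also have "\<dots> \<le> \<epsilon>"
  proof (rule cSUP_least)
    show "{y'. norm y' \<le> 1} \<noteq> {}" by (auto intro: exI[of _ 0])
    fix y' :: 'a assume "y' \<in> {y'. norm y' \<le> 1}"
    then have "\<epsilon> * norm y' \<le> \<epsilon> * 1" using \<open>0 \<le> \<epsilon>\<close> by (intro mult_left_mono) auto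
    with le[of y'] show "\<bar>p y' y\<bar> \<le> \<epsilon>" by simp
  qed
  finally show ?thesis .
qed

lemma norming_eq_right:
  assumes p: "norming_dual_pair p" and eq: "\<And>y'. p y' z = p y' w"
  shows "z = w"
proof -
  have "norm (z - w) \<le> 0"
    using norming_bounded_bilinear[OF p]
    by (intro norming_norm_le[OF p]) (simp_all add: bounded_bilinear.diff_right eq)
  then show ?thesis by simp
qed

lemma norming_eq_left: "norming_dual_pair p \<Longrightarrow> (\<And>y. p z y = p w y) \<Longrightarrow> z = w"
  using norming_eq_right[of "\<lambda>y y'. p y' y" z w] norming_dual_pair_flip by blast

lemma act_right_eq:
  assumes "\<And>z w. (\<And>y'. p y' z = p y' w) \<Longrightarrow> z = w" and "\<And>y'. p y' z = L y' y"
  shows "act_right p L y = z"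
  unfolding act_right_def
  by (rule the_equality) (simp add: assms(2), rule assms(1), simp add: assms(2))

lemma act_left_eq:
  assumes "\<And>z w. (\<And>y. p z y = p w y) \<Longrightarrow> z = w" and "\<And>y. p z' y = L y' y"
  shows "act_left p L y' = z'"
  unfolding act_left_def
  by (rule the_equality) (simp add: assms(2), rule assms(1), simp add: assms(2))

lemma norming_act_right:
  "norming_dual_pair p \<Longrightarrow> (\<And>y'. p y' z = L y' y) \<Longrightarrow> act_right p L y = z"
  by (rule act_right_eq) (rule norming_eq_right)

lemma norming_act_left:
  "norming_dual_pair p \<Longrightarrow> (\<And>y. p z' y = L y' y) \<Longrightarrow> act_left p L y' = z'"
  by (rule act_left_eq) (rule norming_eq_left)

text \<open>The composition may be evaluated with all of the action on the vector, or, in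
  \<open>twin_comp_eq_left\<close>, with all of it on the functional.\<close>

lemma twin_comp_eq_right:
  assumes p: "norming_dual_pair p" and L: "represented p L1" and z: "\<And>y'. p y' z = L2 y' y"
  shows "twin_comp p L1 L2 y' y = L1 y' z"
proof -
  from L obtain z' where z': "\<And>x. p z' x = L1 y' x" unfolding represented_def by meson
  show ?thesis
    unfolding twin_comp_def norming_act_left[of p z' L1 y', OF p z'] norming_act_right[of p z L2 y, OF p z] by (rule z')
qed

lemma twin_comp_eq_left:
  assumes p: "norming_dual_pair p" and L: "represented p L2" and z': "\<And>x. p z' x = L1 y' x"
  shows "twin_comp p L1 L2 y' y = L2 z' y"
proof -
  from L obtain z where z: "\<And>x'. p x' z = L2 x' y" unfolding represented_def by meson
  show ?thesis
    unfolding twin_comp_def norming_act_left[of p z' L1 y', OF p z'] norming_act_right[of p z L2 y, OF p z] by (rule z)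
qed

section \<open>Complexification\<close>

lemma complexify_form_real:
  assumes "bounded_bilinear B"
  shows "complexify_form B (y', 0) u = Complex (B y' (fst u)) (B y' (snd u))"
    and "complexify_form B u' (y, 0) = Complex (B (fst u') y) (B (snd u') y)"
  using assms by (simp_all add: complexify_form_def bounded_bilinear.zero_left
      bounded_bilinear.zero_right)

lemma complexify_form_bounded_bilinear:
  fixes B :: "'b::real_normed_vector \<Rightarrow> 'a::real_normed_vector \<Rightarrow> real"
  assumes B: "bounded_bilinear B"
  shows "bounded_bilinear (complexify_form B)"
proof (rule bounded_bilinear.intro)
  note [simp] = bounded_bilinear.add_left[OF B] bounded_bilinear.add_right[OF B]
    bounded_bilinear.scaleR_left[OF B] bounded_bilinear.scaleR_right[OF B]
  fix u' v' :: "'b \<times> 'b" and u v :: "'a \<times> 'a" and c :: real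
  show "complexify_form B (u' + v') u = complexify_form B u' u + complexify_form B v' u"
    "complexify_form B u' (u + v) = complexify_form B u' u + complexify_form B u' v"
    "complexify_form B (c *\<^sub>R u') u = c *\<^sub>R complexify_form B u' u"
    "complexify_form B u' (c *\<^sub>R u) = c *\<^sub>R complexify_form B u' u"
    by (simp_all add: complexify_form_def complex_eq_iff algebra_simps)
next
  from bounded_bilinear.nonneg_bounded[OF B] obtain K
    where K: "0 \<le> K" "\<And>a b. \<bar>B a b\<bar> \<le> norm a * norm b * K" by auto
  have le: "\<bar>B a b\<bar> \<le> norm u' * norm u * K"
    if "norm a \<le> norm u'" "norm b \<le> norm u" for a b and u' :: "'b \<times> 'b" and u :: "'a \<times> 'a"
    using K(2)[of a b] mult_right_mono[OF mult_mono[OF that] K(1)] by simp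
  have fs: "norm (fst w) \<le> norm w" "norm (snd w) \<le> norm w"
    for w :: "'z::real_normed_vector \<times> 'z"
    using norm_fst_le[of "fst w" "snd w"] norm_snd_le[of "snd w" "fst w"] by simp_all
  have "norm (complexify_form B u' u) \<le> norm u' * norm u * (4 * K)"
    for u' :: "'b \<times> 'b" and u :: "'a \<times> 'a"
  proof -
    have "norm (complexify_form B u' u) \<le> \<bar>B (fst u') (fst u) - B (snd u') (snd u)\<bar>
        + \<bar>B (fst u') (snd u) + B (snd u') (fst u)\<bar>"
      using cmod_le[of "complexify_form B u' u"] by (simp add: complexify_form_def)
    also have "\<dots> \<le> norm u' * norm u * (4 * K)"
      using le[OF fs(1)[of u'] fs(1)[of u]] le[OF fs(1)[of u'] fs(2)[of u]]
        le[OF fs(2)[of u'] fs(1)[of u]] le[OF fs(2)[of u'] fs(2)[of u]] by linarith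
    finally show ?thesis .
  qed
  then show "\<exists>K. \<forall>u' u. norm (complexify_form B u' u) \<le> norm u' * norm u * K" by blast
qed

lemma complexify_form_cscale:
  fixes B :: "'b::real_normed_vector \<Rightarrow> 'a::real_normed_vector \<Rightarrow> real"
  assumes B: "bounded_bilinear B"
  shows "complexify_form B (cscale c u') u = c * complexify_form B u' u"
    and "complexify_form B u' (cscale c u) = c * complexify_form B u' u"
  by (simp_all add: complexify_form_def cscale_def complex_eq_iff algebra_simps
      bounded_bilinear.add_left[OF B] bounded_bilinear.add_right[OF B]
      bounded_bilinear.diff_left[OF B] bounded_bilinear.diff_right[OF B]
      bounded_bilinear.scaleR_left[OF B] bounded_bilinear.scaleR_right[OF B])

lemma complexify_eq_right:
  assumes p: "norming_dual_pair p"
    and eq: "\<And>u'. complexify_form p u' z = complexify_form p u' w"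
  shows "z = w"
proof -
  note bb = norming_bounded_bilinear[OF p]
  have "fst z = fst w" "snd z = snd w"
    using eq[of "(_, 0)"] by (simp_all add: norming_eq_right[OF p] complexify_form_real[OF bb])
  then show ?thesis by (simp add: prod_eq_iff)
qed

lemma complexify_act_right:
  "norming_dual_pair p \<Longrightarrow> (\<And>u'. complexify_form p u' z = L u' u) \<Longrightarrow>
    act_right (complexify_form p) L u = z"
  by (rule act_right_eq) (rule complexify_eq_right)

text \<open>The transform on the complexification is the complex bilinear extension of scalar Laplace
  integrals of real functions.\<close>

lemma laplace_eq_laplace_integral:
  assumes S: "\<And>y' y. exp_dominated a (A y' y) (causal (\<lambda>t. S t y' y))" and "a < Re \<zeta>"
  defines "l \<equiv> \<lambda>y' y. laplace_integral \<zeta> (causal (\<lambda>t. S t y' y))"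
  shows "laplace S \<zeta> u' u
      = l (fst u') (fst u) - l (snd u') (snd u) + \<i> * (l (fst u') (snd u) + l (snd u') (fst u))"
proof -
  let ?e = "\<lambda>y' y t. exp (- \<zeta> * of_real t) * complex_of_real (causal (\<lambda>t. S t y' y) t)"
  have int: "integrable lborel (?e y' y)" for y' y
    by (rule integrable_laplace[OF S \<open>a < Re \<zeta>\<close>])
  have "laplace S \<zeta> u' u = (LINT t|lborel. ?e (fst u') (fst u) t - ?e (snd u') (snd u) t
      + \<i> * (?e (fst u') (snd u) t + ?e (snd u') (fst u) t))"
    unfolding laplace_def set_lebesgue_integral_def
    by (intro Bochner_Integration.integral_cong refl)
      (auto simp: complexify_form_def causal_def Complex_eq algebra_simps)
  also have "\<dots> = l (fst u') (fst u) - l (snd u') (snd u)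
      + \<i> * (l (fst u') (snd u) + l (snd u') (fst u))"
    using int by (simp add: l_def laplace_integral_def)
  finally show ?thesis .
qed

section \<open>The resolvent kernel\<close>

text \<open>The integrability of the entries has to be used: a vector valued integral is zero by convention
  when its integrand fails to be integrable.\<close>

lemma integral_vec_nth2:
  fixes h :: "real \<Rightarrow> real^'n^'m"
  assumes "\<And>i j. integrable lborel (\<lambda>t. h t $ i $ j)"
  shows "(LINT t|lborel. h t) $ i $ j = (LINT t|lborel. h t $ i $ j)"
proof -
  have h: "h = (\<lambda>t. \<Sum>i\<in>UNIV. \<Sum>j\<in>UNIV. (h t $ i $ j) *\<^sub>R axis i (axis j 1))"
  proof
    fix t
    have "(\<Sum>b\<in>UNIV. (h t $ a $ b) *\<^sub>R axis a (axis b 1)) $ i $ j = (if a = i then h t $ i $ j else 0)"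
      for a i j
      by (simp add: axis_def if_distrib[of "\<lambda>x. _ * x"] if_distrib[of "\<lambda>x. x $ _"] cong: if_cong)
    then show "h t = (\<Sum>i\<in>UNIV. \<Sum>j\<in>UNIV. (h t $ i $ j) *\<^sub>R axis i (axis j 1))"
      by (simp add: vec_eq_iff)
  qed
  have "integrable lborel h"
    by (subst h) (intro Bochner_Integration.integrable_sum integrable_scaleR_left assms)
  moreover have "bounded_linear (\<lambda>x::real^'n^'m. x $ i $ j)"
    by (rule bounded_linear_compose[OF bounded_linear_vec_nth bounded_linear_vec_nth])
  ultimately show ?thesis using integral_bounded_linear[of "\<lambda>x. x $ i $ j" lborel h] by simp
qed

text \<open>Before an exponential bound on the resolvent kernel is known, cutting it off at \<open>T\<close> makes
  the convolution lemmas applicable; by causality this does not change convolutions up to time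
  \<open>T\<close>.\<close>

definition truncate :: "real \<Rightarrow> (real \<Rightarrow> real) \<Rightarrow> real \<Rightarrow> real" where
  "truncate T f t = (if 0 \<le> t \<and> t \<le> T then f t else 0)"

lemma convolve_truncate:
  assumes "\<And>t. t < 0 \<Longrightarrow> F t = 0" and "t \<le> T"
  shows "(F \<star> truncate T f) t = (F \<star> causal f) t"
  using assms by (intro convolve_cong) (auto simp: truncate_def causal_def)

lemma conv_component:
  assumes "\<And>i j. exp_bounded (truncate t (\<lambda>s. f s $ i $ j))"
    and "\<And>i j. exp_bounded (truncate t (\<lambda>s. g s $ i $ j))"
  shows "conv f g t $ i $ j = (\<Sum>l\<in>UNIV. (causal (\<lambda>s. f s $ i $ l) \<star> causal (\<lambda>s. g s $ l $ j)) t)"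
proof -
  let ?F = "\<lambda>i j. truncate t (\<lambda>s. f s $ i $ j)" and ?G = "\<lambda>i j. truncate t (\<lambda>s. g s $ i $ j)"
  have eq: "(indicator {0..t} s *\<^sub>R (f (t - s) ** g s)) $ i $ j
      = (\<Sum>l\<in>UNIV. ?F i l (t - s) * ?G l j s)" for s i j
    by (auto simp: matrix_matrix_mult_def truncate_def indicator_def)
  have int: "integrable lborel (\<lambda>s. ?F i l (t - s) * ?G l j s)" for i l j
    using assms by (intro integrable_convolution)
  have "conv f g t $ i $ j = (\<Sum>l\<in>UNIV. (?F i l \<star> ?G l j) t)"
    unfolding conv_def set_lebesgue_integral_def convolve_def
    by (subst integral_vec_nth2) (simp_all only: eq int Bochner_Integration.integral_sum
        Bochner_Integration.integrable_sum)
  also have "\<dots> = (\<Sum>l\<in>UNIV. (causal (\<lambda>s. f s $ i $ l) \<star> causal (\<lambda>s. g s $ l $ j)) t)"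
  proof (intro sum.cong refl)
    fix l
    have "(?F i l \<star> ?G l j) t = (?F i l \<star> causal (\<lambda>s. g s $ l $ j)) t"
      by (rule convolve_truncate) (auto simp: truncate_def)
    also have "\<dots> = (causal (\<lambda>s. g s $ l $ j) \<star> causal (\<lambda>s. f s $ i $ l)) t"
      by (subst convolve_commute, rule convolve_truncate) auto
    finally show "(?F i l \<star> ?G l j) t = (causal (\<lambda>s. f s $ i $ l) \<star> causal (\<lambda>s. g s $ l $ j)) t"
      by (simp add: convolve_commute)
  qed
  finally show ?thesis .
qed

lemma truncate_dominated:
  assumes f: "f \<in> borel_measurable (restrict_space borel {0..})"
    and B: "\<And>t. 0 \<le> t \<Longrightarrow> t \<le> T \<Longrightarrow> \<bar>f t\<bar> \<le> B * exp (a * t)" and "0 \<le> B"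
  shows "exp_dominated a B (truncate T f)"
proof -
  have "truncate T f = (\<lambda>t. causal f t * indicator {..T} t)"
    by (auto simp: truncate_def causal_def indicator_def)
  then have "truncate T f \<in> borel_measurable borel"
    using measurable_causal[OF f] by simp
  with B \<open>0 \<le> B\<close> show ?thesis by (auto simp: exp_dominated_def truncate_def)
qed

lemma measurable_entry:
  fixes f :: "real \<Rightarrow> real^'n^'m"
  assumes "f \<in> borel_measurable N"
  shows "(\<lambda>t. f t $ i $ j) \<in> borel_measurable N"
  using assms by (intro borel_measurable_continuous_on[of "\<lambda>x. x $ i $ j" f N] continuous_intros)

locale twin_perturbation =
  fixes p :: "'b::banach \<Rightarrow> 'a::banach \<Rightarrow> real"
    and S\<^sub>0 :: "real \<Rightarrow> 'b \<Rightarrow> 'a \<Rightarrow> real"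
    and q :: "'n::finite \<Rightarrow> 'a"
    and q' :: "'n \<Rightarrow> 'b"
    and r :: "real \<Rightarrow> real^'n^'n"
    and M \<omega> :: real
  assumes norming: "norming_dual_pair p"
    and semigroup: "twin_semigroup_with M \<omega> p S\<^sub>0"
    and resolvent: "is_resolvent (pert_kernel S\<^sub>0 q q') r"
begin

definition orbit :: "'b \<Rightarrow> 'a \<Rightarrow> real \<Rightarrow> real" where
  "orbit y' y = causal (\<lambda>t. S\<^sub>0 t y' y)"

abbreviation K :: "'n \<Rightarrow> 'n \<Rightarrow> real \<Rightarrow> real" where
  "K i j \<equiv> orbit (q' i) (q j)"

definition R :: "'n \<Rightarrow> 'n \<Rightarrow> real \<Rightarrow> real" where
  "R i j = causal (\<lambda>t. r t $ i $ j)"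

lemma
  shows S0_twin: "0 \<le> t \<Longrightarrow> twin_operator p (S\<^sub>0 t)"
    and S0_zero: "S\<^sub>0 0 = p"
    and S0_plus: "0 \<le> t \<Longrightarrow> 0 \<le> s \<Longrightarrow> S\<^sub>0 (t + s) = twin_comp p (S\<^sub>0 t) (S\<^sub>0 s)"
    and M_ge_1: "1 \<le> M"
    and S0_bound: "0 \<le> t \<Longrightarrow> \<bar>S\<^sub>0 t y' y\<bar> \<le> M * exp (\<omega> * t) * norm y * norm y'"
    and S0_measurable: "(\<lambda>t. S\<^sub>0 t y' y) \<in> borel_measurable (restrict_space borel {0..})"
    and S0_laplace: "\<omega> < Re \<zeta> \<Longrightarrow> complex_twin_operator p (laplace S\<^sub>0 \<zeta>)"
  using semigroup unfolding twin_semigroup_with_def by auto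

lemma p_bounded_bilinear: "bounded_bilinear p"
  by (rule norming_bounded_bilinear[OF norming])

lemma S0_bounded_bilinear: "0 \<le> t \<Longrightarrow> bounded_bilinear (S\<^sub>0 t)"
  and S0_represented: "0 \<le> t \<Longrightarrow> represented p (S\<^sub>0 t)"
  using S0_twin[of t] by (auto simp: twin_operator_def)

lemma orbit_dominated: "exp_dominated \<omega> (M * norm y * norm y') (orbit y' y)"
  unfolding exp_dominated_def orbit_def
  using S0_bound[of _ y' y] measurable_causal[OF S0_measurable, of y' y] by (simp add: ac_simps)

lemma orbit_exp_bounded [simp, intro]: "exp_bounded (orbit y' y)"
  by (rule exp_boundedI[OF orbit_dominated])

lemma orbit_neg [simp]: "t < 0 \<Longrightarrow> orbit y' y t = 0"
  by (simp add: orbit_def)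

lemma orbit_add_right: "orbit y' (x + y) t = orbit y' x t + orbit y' y t"
  and orbit_add_left: "orbit (x' + y') y t = orbit x' y t + orbit y' y t"
  and orbit_scale_right: "orbit y' (c *\<^sub>R y) t = c * orbit y' y t"
  and orbit_scale_left: "orbit (c *\<^sub>R y') y t = c * orbit y' y t"
  using S0_bounded_bilinear[of t]
  by (auto simp: orbit_def causal_def bounded_bilinear.add_left bounded_bilinear.add_right
      bounded_bilinear.scaleR_left bounded_bilinear.scaleR_right)

lemma orbit_zero: "orbit y' 0 = (\<lambda>t. 0)" "orbit 0 y = (\<lambda>t. 0)"
  using orbit_scale_right[of y' 0 y] orbit_scale_left[of 0 y' y] by (auto simp: fun_eq_iff)

lemma r_measurable: "(\<lambda>t. r t $ i $ j) \<in> borel_measurable (restrict_space borel {0..})"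
  using resolvent by (intro measurable_entry) (simp add: is_resolvent_def)

lemma r_locally_bounded: "\<exists>b\<ge>0. \<forall>t i j. 0 \<le> t \<longrightarrow> t \<le> T \<longrightarrow> \<bar>r t $ i $ j\<bar> \<le> b"
proof -
  have "bounded (r ` {0..T})" using resolvent unfolding is_resolvent_def by blast
  then obtain b where "0 < b" and b: "\<And>t. t \<in> {0..T} \<Longrightarrow> norm (r t) \<le> b"
    by (auto simp: bounded_pos)
  have "\<bar>r t $ i $ j\<bar> \<le> norm (r t)" for t i j
    using component_le_norm_cart[of "r t $ i" j] Finite_Cartesian_Product.norm_nth_le[of "r t" i]
    by linarith
  with b \<open>0 < b\<close> show ?thesis by (intro exI[of _ b]) (meson atLeastAtMost_iff order_trans less_imp_le)
qed

lemma truncate_r: "exp_bounded (truncate T (\<lambda>t. r t $ i $ j))"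
proof -
  obtain b where "0 \<le> b" "\<And>t i j. 0 \<le> t \<Longrightarrow> t \<le> T \<Longrightarrow> \<bar>r t $ i $ j\<bar> \<le> b"
    using r_locally_bounded[of T] by blast
  then have "exp_dominated 0 b (truncate T (\<lambda>t. r t $ i $ j))"
    by (intro truncate_dominated r_measurable) auto
  then show ?thesis by (rule exp_boundedI)
qed

lemma truncate_k: "exp_bounded (truncate T (\<lambda>t. pert_kernel S\<^sub>0 q q' t $ i $ j))"
proof -
  let ?C = "M * norm (q j) * norm (q' i)"
  have "\<bar>S\<^sub>0 t (q' i) (q j)\<bar> \<le> ?C * exp (\<omega> * t)" if "0 \<le> t" for t
    using S0_bound[OF that] by (simp add: ac_simps)
  then have "exp_dominated \<omega> ?C (truncate T (\<lambda>t. pert_kernel S\<^sub>0 q q' t $ i $ j))"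
    using M_ge_1 by (intro truncate_dominated) (auto simp: pert_kernel_def S0_measurable)
  then show ?thesis by (rule exp_boundedI)
qed

lemma causal_kernel: "causal (\<lambda>t. pert_kernel S\<^sub>0 q q' t $ i $ j) = K i j"
  by (simp add: pert_kernel_def orbit_def)

text \<open>The two resolvent equations, entry by entry. They hold at negative times as well, where both
  sides vanish.\<close>

lemma resolvent_right: "R i j t = K i j t + (\<Sum>l\<in>UNIV. (K i l \<star> R l j) t)"
  and resolvent_left: "R i j t = K i j t + (\<Sum>l\<in>UNIV. (R i l \<star> K l j) t)"
proof -
  let ?k = "pert_kernel S\<^sub>0 q q'"
  have *: "R i j t = K i j t + (\<Sum>l\<in>UNIV. (K i l \<star> R l j) t) \<and>
      R i j t = K i j t + (\<Sum>l\<in>UNIV. (R i l \<star> K l j) t)"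
  proof (cases "0 \<le> t")
    case True
    then have "?k t + conv ?k r t = r t" "r t = ?k t + conv r ?k t"
      using resolvent by (auto simp: is_resolvent_def)
    then have "r t $ i $ j = ?k t $ i $ j + conv ?k r t $ i $ j"
      "r t $ i $ j = ?k t $ i $ j + conv r ?k t $ i $ j"
      by (metis vector_add_component)+
    then show ?thesis
      using True
      by (simp add: conv_component truncate_r truncate_k causal_kernel)
        (simp add: R_def orbit_def pert_kernel_def)
  next
    case False
    have "(K i l \<star> R l j) t = 0" "(R i l \<star> K l j) t = 0" for l
      using False by (auto intro!: convolve_neg simp: R_def)
    then show ?thesis using False by (simp add: R_def)
  qed
  then show "R i j t = K i j t + (\<Sum>l\<in>UNIV. (K i l \<star> R l j) t)"
    "R i j t = K i j t + (\<Sum>l\<in>UNIV. (R i l \<star> K l j) t)" by auto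
qed

definition \<kappa> :: real where "\<kappa> = (\<Sum>i\<in>UNIV. \<Sum>j\<in>UNIV. M * norm (q j) * norm (q' i))"

text \<open>With this exponent the Volterra operator with kernel \<open>K\<close> has norm at most one half in the
  weight \<open>exp (\<alpha> * t)\<close>, see \<open>convolve_bound\<close>. The summand 1 keeps
  \<open>\<alpha> - \<omega>\<close> positive when the kernel vanishes.\<close>

definition \<alpha> :: real where "\<alpha> = \<omega> + 2 * \<kappa> * CARD('n) + 1"

lemma K_dominated: "exp_dominated \<omega> \<kappa> (K i j)"
proof (rule exp_dominated_mono[OF orbit_dominated])
  have "M * norm (q j) * norm (q' i) \<le> (\<Sum>j\<in>UNIV. M * norm (q j) * norm (q' i))"
    using M_ge_1 by (intro member_le_sum) auto
  also have "\<dots> \<le> \<kappa>"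
    unfolding \<kappa>_def using M_ge_1
    by (intro member_le_sum[of i UNIV "\<lambda>i. \<Sum>j\<in>UNIV. M * norm (q j) * norm (q' i)"])
      (auto intro!: sum_nonneg)
  finally show "M * norm (q j) * norm (q' i) \<le> \<kappa>" .
qed simp

lemma kappa_nonneg: "0 \<le> \<kappa>"
  using exp_dominatedD(4)[OF K_dominated] .

lemma omega_less_alpha: "\<omega> < \<alpha>"
  using kappa_nonneg by (auto simp: \<alpha>_def intro: add_nonneg_pos)

text \<open>Let \<open>B\<close> be the supremum of the entries of the resolvent kernel on \<open>{0..T}\<close> in the weight
  \<open>exp (\<alpha> * t)\<close>, which is finite by local boundedness. The resolvent equation and the
  contraction property give \<open>B \<le> \<kappa> + B / 2\<close>, a bound that is independent of \<open>T\<close>.\<close>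

lemma R_dominated: "exp_dominated \<alpha> (2 * \<kappa>) (R i j)"
proof -
  have "\<bar>r T $ i $ j\<bar> \<le> 2 * \<kappa> * exp (\<alpha> * T)" if "0 \<le> T" for T
  proof -
    define X where "X = {exp (- (\<alpha> * t)) * \<bar>r t $ i $ j\<bar> | t i j. 0 \<le> t \<and> t \<le> T}"
    obtain b where b: "0 \<le> b" "\<And>t i j. 0 \<le> t \<Longrightarrow> t \<le> T \<Longrightarrow> \<bar>r t $ i $ j\<bar> \<le> b"
      using r_locally_bounded[of T] by metis
    have bdd: "bdd_above X"
    proof (rule bdd_aboveI)
      fix x assume "x \<in> X"
      then obtain t i j where x: "x = exp (- (\<alpha> * t)) * \<bar>r t $ i $ j\<bar>" and t: "0 \<le> t" "t \<le> T"
        by (auto simp: X_def)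
      have "- (\<alpha> * t) \<le> \<bar>\<alpha>\<bar> * t"
        using t abs_ge_minus_self[of \<alpha>] mult_right_mono[of "- \<alpha>" "\<bar>\<alpha>\<bar>" t] by simp
      also have "\<dots> \<le> \<bar>\<alpha>\<bar> * T" using t by (intro mult_left_mono) auto
      finally show "x \<le> exp (\<bar>\<alpha>\<bar> * T) * b"
        unfolding x using b t by (intro mult_mono) auto
    qed
    define B where "B = Sup X"
    have XB: "exp (- (\<alpha> * t)) * \<bar>r t $ i $ j\<bar> \<le> B" if "0 \<le> t" "t \<le> T" for t i j
    proof -
      have "exp (- (\<alpha> * t)) * \<bar>r t $ i $ j\<bar> \<in> X" unfolding X_def using that by blast
      then show ?thesis unfolding B_def using bdd by (rule cSup_upper)
    qed
    have rB: "\<bar>r t $ i $ j\<bar> \<le> B * exp (\<alpha> * t)" if "0 \<le> t" "t \<le> T" for t i j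
      using XB[OF that, of i j] by (simp add: exp_minus divide_simps)
    have "\<bar>r 0 $ i $ j\<bar> \<le> B" using XB[of 0 i j] that by simp
    then have "0 \<le> B" by linarith
    have tr: "exp_dominated \<alpha> B (truncate T (\<lambda>t. r t $ i $ j))" for i j
      using rB \<open>0 \<le> B\<close> by (intro truncate_dominated r_measurable) auto
    have half: "\<kappa> * CARD('n) / (\<alpha> - \<omega>) \<le> 1 / 2"
    proof -
      have "0 \<le> \<kappa> * CARD('n)" using kappa_nonneg by simp
      then have "0 < \<alpha> - \<omega>" "2 * (\<kappa> * CARD('n)) \<le> \<alpha> - \<omega>" by (simp_all add: \<alpha>_def)
      then show ?thesis by (simp add: pos_divide_le_eq)
    qed
    have "B \<le> \<kappa> + B / 2"
      unfolding B_def
    proof (rule cSup_least)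
      show "X \<noteq> {}" using that by (auto simp: X_def)
      fix x assume "x \<in> X"
      then obtain t i j where x: "x = exp (- (\<alpha> * t)) * \<bar>r t $ i $ j\<bar>" and t: "0 \<le> t" "t \<le> T"
        by (auto simp: X_def)
      have "r t $ i $ j = K i j t + (\<Sum>l\<in>UNIV. (K i l \<star> truncate T (\<lambda>t. r t $ l $ j)) t)"
        using resolvent_right[of i j t] t by (simp add: convolve_truncate R_def)
      also have "\<bar>\<dots>\<bar> \<le> \<kappa> * exp (\<alpha> * t) + (\<Sum>l\<in>(UNIV::'n set). \<kappa> * B / (\<alpha> - \<omega>) * exp (\<alpha> * t))"
      proof (rule order_trans[OF abs_triangle_ineq], rule add_mono)
        show "\<bar>K i j t\<bar> \<le> \<kappa> * exp (\<alpha> * t)"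
          using omega_less_alpha
          by (intro exp_dominatedD(5) exp_dominated_mono[OF K_dominated]) auto
        show "\<bar>\<Sum>l\<in>UNIV. (K i l \<star> truncate T (\<lambda>t. r t $ l $ j)) t\<bar>
            \<le> (\<Sum>l\<in>(UNIV::'n set). \<kappa> * B / (\<alpha> - \<omega>) * exp (\<alpha> * t))"
          by (intro order_trans[OF sum_abs] sum_mono
              exp_dominatedD(5)[OF convolve_bound[OF K_dominated tr omega_less_alpha]])
      qed
      also have "\<dots> = (\<kappa> + B * (\<kappa> * CARD('n) / (\<alpha> - \<omega>))) * exp (\<alpha> * t)"
        unfolding divide_inverse by (simp add: algebra_simps)
      also have "\<dots> \<le> (\<kappa> + B * (1 / 2)) * exp (\<alpha> * t)"
        using half \<open>0 \<le> B\<close> by (intro mult_right_mono add_left_mono mult_left_mono) auto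
      finally have "x \<le> exp (- (\<alpha> * t)) * ((\<kappa> + B * (1 / 2)) * exp (\<alpha> * t))"
        unfolding x by (intro mult_left_mono) auto
      also have "\<dots> = \<kappa> + B * (1 / 2)" by (simp add: exp_minus)
      finally show "x \<le> \<kappa> + Sup X / 2" by (simp add: B_def)
    qed
    then have "B \<le> 2 * \<kappa>" by simp
    then have "B * exp (\<alpha> * T) \<le> 2 * \<kappa> * exp (\<alpha> * T)" by (intro mult_right_mono) auto
    with rB[of T i j] that show ?thesis by linarith
  qed
  then show ?thesis
    using measurable_causal[OF r_measurable, of i j] by (simp add: exp_dominated_def R_def)
qed

lemma R_exp_bounded [simp, intro]: "exp_bounded (R i j)"
  by (rule exp_boundedI[OF R_dominated])

section \<open>The renewal equation\<close>

text \<open>\<open>k + k * r = r\<close> says that \<open>h + r * h\<close> solves the renewal equation; the other resolvent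
  equation says, in \<open>renewal_unique\<close>, that there is no other solution.\<close>

lemma renewal_solution:
  assumes H: "\<And>i. exp_bounded (H i)"
    and V: "\<And>i t. V i t = H i t + (\<Sum>j\<in>UNIV. (R i j \<star> H j) t)"
  shows "V i t = H i t + (\<Sum>j\<in>UNIV. (K i j \<star> V j) t)"
proof -
  have V': "V j = (\<lambda>t. H j t + (\<Sum>l\<in>UNIV. (R j l \<star> H l) t))" for j using V by auto
  have RK: "(\<lambda>t. R i j t - K i j t) = (\<lambda>t. \<Sum>l\<in>UNIV. (K i l \<star> R l j) t)" for j
    using resolvent_right[of i j] by auto
  have "(K i j \<star> V j) t = (K i j \<star> H j) t + (\<Sum>l\<in>UNIV. (K i j \<star> (R j l \<star> H l)) t)" for j
    unfolding V' using H
    by (simp add: convolve_add_right convolve_sum_right exp_bounded_intros)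
  then have "(\<Sum>j\<in>UNIV. (K i j \<star> V j) t)
      = (\<Sum>j\<in>UNIV. (K i j \<star> H j) t) + (\<Sum>j\<in>UNIV. \<Sum>l\<in>UNIV. (K i j \<star> (R j l \<star> H l)) t)"
    by (simp add: sum.distrib)
  also have "(\<Sum>j\<in>UNIV. \<Sum>l\<in>UNIV. (K i j \<star> (R j l \<star> H l)) t)
      = (\<Sum>l\<in>UNIV. \<Sum>j\<in>UNIV. (K i j \<star> R j l \<star> H l) t)"
    using H by (subst sum.swap) (simp add: convolve_assoc)
  also have "\<dots> = (\<Sum>l\<in>UNIV. ((\<lambda>t. R i l t - K i l t) \<star> H l) t)"
    unfolding RK using H by (simp add: convolve_sum_left exp_bounded_intros)
  also have "\<dots> = (\<Sum>l\<in>UNIV. (R i l \<star> H l) t) - (\<Sum>l\<in>UNIV. (K i l \<star> H l) t)"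
    using H by (simp add: convolve_diff_left sum_subtractf)
  finally show ?thesis using V[of i t] by simp
qed

lemma renewal_unique:
  assumes H: "\<And>i. exp_bounded (H i)" and U: "\<And>i. exp_bounded (U i)"
    and eq: "\<And>i t. U i t = H i t + (\<Sum>j\<in>UNIV. (K i j \<star> U j) t)"
  shows "U i t = H i t + (\<Sum>j\<in>UNIV. (R i j \<star> H j) t)"
proof -
  have H': "H j = (\<lambda>t. U j t - (\<Sum>l\<in>UNIV. (K j l \<star> U l) t))" for j using eq by auto
  have RK: "(\<lambda>t. R i j t - K i j t) = (\<lambda>t. \<Sum>l\<in>UNIV. (R i l \<star> K l j) t)" for j
    using resolvent_left[of i j] by auto
  have "(\<Sum>j\<in>UNIV. (R i j \<star> H j) t)
      = (\<Sum>j\<in>UNIV. (R i j \<star> U j) t) - (\<Sum>j\<in>UNIV. \<Sum>l\<in>UNIV. (R i j \<star> (K j l \<star> U l)) t)"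
    unfolding H' using U
    by (simp add: convolve_diff_right convolve_sum_right exp_bounded_intros sum_subtractf)
  also have "(\<Sum>j\<in>UNIV. \<Sum>l\<in>UNIV. (R i j \<star> (K j l \<star> U l)) t)
      = (\<Sum>l\<in>UNIV. \<Sum>j\<in>UNIV. (R i j \<star> K j l \<star> U l) t)"
    using U by (subst sum.swap) (simp add: convolve_assoc)
  also have "\<dots> = (\<Sum>l\<in>UNIV. ((\<lambda>t. R i l t - K i l t) \<star> U l) t)"
    unfolding RK using U by (simp add: convolve_sum_left exp_bounded_intros)
  also have "\<dots> = (\<Sum>l\<in>UNIV. (R i l \<star> U l) t) - (\<Sum>l\<in>UNIV. (K i l \<star> U l) t)"
    using U by (simp add: convolve_diff_left sum_subtractf)
  finally show ?thesis using eq[of i t] by simp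
qed

section \<open>The perturbed family\<close>

definition V :: "'n \<Rightarrow> 'a \<Rightarrow> real \<Rightarrow> real" where
  "V i y t = orbit (q' i) y t + (\<Sum>j\<in>UNIV. (R i j \<star> orbit (q' j) y) t)"

definition W :: "'n \<Rightarrow> 'b \<Rightarrow> real \<Rightarrow> real" where
  "W j y' t = orbit y' (q j) t + (\<Sum>i\<in>UNIV. (orbit y' (q i) \<star> R i j) t)"

definition perturbed_orbit :: "'b \<Rightarrow> 'a \<Rightarrow> real \<Rightarrow> real" where
  "perturbed_orbit y' y t = orbit y' y t + (\<Sum>j\<in>UNIV. (orbit y' (q j) \<star> V j y) t)"

lemma V_exp_bounded [simp, intro]: "exp_bounded (V i y)"
  unfolding V_def by (intro exp_bounded_intros) auto

lemma W_exp_bounded [simp, intro]: "exp_bounded (W i y)"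
  unfolding W_def by (intro exp_bounded_intros) auto

lemma perturbed_orbit_exp_bounded [simp, intro]: "exp_bounded (perturbed_orbit y' y)"
  unfolding perturbed_orbit_def by (intro exp_bounded_intros) auto

lemma causal_pert_v: "causal (\<lambda>t. pert_v S\<^sub>0 q' r i t y) = V i y"
proof
  fix t
  show "causal (\<lambda>t. pert_v S\<^sub>0 q' r i t y) t = V i y t"
  proof (cases "0 \<le> t")
    case True
    then show ?thesis
      unfolding V_def pert_v_def R_def orbit_def
      by (simp flip: set_integral_eq_convolve)
  next
    case False
    then show ?thesis using exp_boundedD(2)[OF V_exp_bounded, of t i y] by simp
  qed
qed

lemma causal_pert_w: "causal (\<lambda>t. pert_w S\<^sub>0 q r j t y') = W j y'"
proof
  fix t
  show "causal (\<lambda>t. pert_w S\<^sub>0 q r j t y') t = W j y' t"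
  proof (cases "0 \<le> t")
    case True
    then show ?thesis
      unfolding W_def pert_w_def R_def orbit_def
      by (simp flip: set_integral_eq_convolve)
  next
    case False
    then show ?thesis using exp_boundedD(2)[OF W_exp_bounded, of t j y'] by simp
  qed
qed

lemma pert_semigroup_eq: "0 \<le> t \<Longrightarrow> pert_semigroup S\<^sub>0 q q' r t y' y = perturbed_orbit y' y t"
  unfolding pert_semigroup_def perturbed_orbit_def causal_pert_v[symmetric] orbit_def
  by (simp flip: set_integral_eq_convolve)

text \<open>Both sides are \<open>S\<^sub>0 + g * h + g * r * h\<close>, with the triple convolution bracketed in the two
  possible ways.\<close>

lemma perturbed_orbit_eq_W:
  "perturbed_orbit y' y t = orbit y' y t + (\<Sum>j\<in>UNIV. (W j y' \<star> orbit (q' j) y) t)"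
proof -
  let ?g = "\<lambda>i. orbit y' (q i)" and ?h = "\<lambda>j. orbit (q' j) y"
  have "(\<Sum>i\<in>UNIV. (?g i \<star> V i y) t)
      = (\<Sum>i\<in>UNIV. (?g i \<star> ?h i) t) + (\<Sum>i\<in>UNIV. \<Sum>j\<in>UNIV. (?g i \<star> (R i j \<star> ?h j)) t)"
    unfolding V_def by (simp add: convolve_add_right convolve_sum_right exp_bounded_intros sum.distrib)
  also have "(\<Sum>i\<in>UNIV. \<Sum>j\<in>UNIV. (?g i \<star> (R i j \<star> ?h j)) t)
      = (\<Sum>j\<in>UNIV. \<Sum>i\<in>UNIV. (?g i \<star> R i j \<star> ?h j) t)"
    by (subst sum.swap) (simp add: convolve_assoc)
  also have "(\<Sum>i\<in>UNIV. (?g i \<star> ?h i) t) + \<dots> = (\<Sum>j\<in>UNIV. (W j y' \<star> ?h j) t)"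
    unfolding W_def by (simp add: convolve_add_left convolve_sum_left exp_bounded_intros sum.distrib)
  finally show ?thesis by (simp add: perturbed_orbit_def)
qed

lemma pert_semigroup'_eq:
  "0 \<le> t \<Longrightarrow> pert_semigroup' S\<^sub>0 q q' r t y' y = perturbed_orbit y' y t"
  unfolding pert_semigroup'_def perturbed_orbit_eq_W causal_pert_w[symmetric] orbit_def
  by (simp flip: set_integral_eq_convolve)

lemma V_renewal: "V i y t = orbit (q' i) y t + (\<Sum>j\<in>UNIV. (K i j \<star> V j y) t)"
  by (rule renewal_solution[where H = "\<lambda>i. orbit (q' i) y"]) (auto simp: V_def)

text \<open>\<open>v\<^sub>i\<close> is the orbit of the functional \<open>q'\<^sub>i\<close> under the perturbed family. The
  semigroup law for \<open>v\<close> is thus an instance of the one for the family itself.\<close>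

lemma V_eq_perturbed_orbit: "V i y = perturbed_orbit (q' i) y"
  by (simp add: fun_eq_iff perturbed_orbit_def V_renewal[symmetric])

lemma V_add: "V i (x + y) t = V i x t + V i y t"
proof -
  have o: "orbit z' (x + y) = (\<lambda>t. orbit z' x t + orbit z' y t)" for z'
    by (simp add: fun_eq_iff orbit_add_right)
  show ?thesis by (simp add: V_def o convolve_add_right sum.distrib)
qed

lemma V_scale: "V i (c *\<^sub>R y) t = c * V i y t"
proof -
  have o: "orbit z' (c *\<^sub>R y) = (\<lambda>t. c * orbit z' y t)" for z'
    by (simp add: fun_eq_iff orbit_scale_right)
  show ?thesis by (simp add: V_def o convolve_cmult_right sum_distrib_left distrib_left)
qed

text \<open>The constants that make the bounds on \<open>V\<close> and on the perturbed family proportional to the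
  norms of the vectors. Each of the two convolutions involved raises the exponent by 1.\<close>

definition \<nu> :: "'n \<Rightarrow> real" where
  "\<nu> i = M * norm (q' i) + (\<Sum>j\<in>(UNIV::'n set). 2 * \<kappa> * (M * norm (q' j)))"

definition M' :: real where
  "M' = max 1 (M + (\<Sum>j\<in>UNIV. M * norm (q j) * \<nu> j))"

lemma V_dominated: "exp_dominated (\<alpha> + 1) (\<nu> i * norm y) (V i y)"
proof -
  have o: "exp_dominated \<alpha> (M * norm y * norm y') (orbit y' y)" for y'
    using omega_less_alpha by (intro exp_dominated_mono[OF orbit_dominated]) auto
  have "exp_dominated (\<alpha> + 1) (M * norm y * norm (q' i) + (\<Sum>j\<in>UNIV. 2 * \<kappa> * (M * norm y * norm (q' j))))
      (\<lambda>t. orbit (q' i) y t + (\<Sum>j\<in>UNIV. (R i j \<star> orbit (q' j) y) t))"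
    by (intro exp_dominated_add exp_dominated_sum exp_dominated_convolve R_dominated o
        exp_dominated_mono[OF o]) auto
  moreover have "M * norm y * norm (q' i) + (\<Sum>j\<in>UNIV. 2 * \<kappa> * (M * norm y * norm (q' j))) = \<nu> i * norm y"
    unfolding \<nu>_def distrib_right sum_distrib_right by (simp only: ac_simps)
  ultimately show ?thesis by (simp add: V_def[abs_def])
qed

lemma perturbed_orbit_dominated:
  "exp_dominated (\<alpha> + 2) (M' * norm y * norm y') (perturbed_orbit y' y)"
proof -
  have o: "exp_dominated b (M * norm x * norm x') (orbit x' x)" if "\<alpha> \<le> b" for x x' b
    using omega_less_alpha that by (intro exp_dominated_mono[OF orbit_dominated]) auto
  let ?c = "M + (\<Sum>j\<in>UNIV. M * norm (q j) * \<nu> j)"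
  have "exp_dominated (\<alpha> + 1 + 1)
      (M * norm y * norm y' + (\<Sum>j\<in>UNIV. (M * norm (q j) * norm y') * (\<nu> j * norm y)))
      (perturbed_orbit y' y)"
    unfolding perturbed_orbit_def[abs_def]
    by (intro exp_dominated_add exp_dominated_sum exp_dominated_convolve V_dominated o) auto
  moreover have "M * norm y * norm y' + (\<Sum>j\<in>UNIV. (M * norm (q j) * norm y') * (\<nu> j * norm y))
      = ?c * (norm y * norm y')"
    unfolding distrib_right sum_distrib_right by (simp only: ac_simps)
  moreover have "?c * (norm y * norm y') \<le> M' * (norm y * norm y')"
    by (intro mult_right_mono) (auto simp: M'_def)
  ultimately have "exp_dominated (\<alpha> + 1 + 1) (M' * (norm y * norm y')) (perturbed_orbit y' y)"
    using exp_dominated_mono[OF _ order_refl] by simp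
  then show ?thesis by (simp add: mult.assoc add.assoc)
qed

lemma perturbed_orbit_bounded_bilinear:
  assumes "0 \<le> t"
  shows "bounded_bilinear (\<lambda>y' y. perturbed_orbit y' y t)"
proof (rule bounded_bilinear.intro)
  fix y' x' :: 'b and y x :: 'a and c :: real
  have V1: "V j (x + y) = (\<lambda>t. V j x t + V j y t)" "V j (c *\<^sub>R y) = (\<lambda>t. c * V j y t)" for j
    by (simp_all add: fun_eq_iff V_add V_scale)
  have o: "orbit (x' + y') z = (\<lambda>t. orbit x' z t + orbit y' z t)"
    "orbit (c *\<^sub>R y') z = (\<lambda>t. c * orbit y' z t)" for z
    by (simp_all add: fun_eq_iff orbit_add_left orbit_scale_left)
  show "perturbed_orbit (x' + y') y t = perturbed_orbit x' y t + perturbed_orbit y' y t"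
    by (simp add: perturbed_orbit_def o convolve_add_left sum.distrib)
  show "perturbed_orbit y' (x + y) t = perturbed_orbit y' x t + perturbed_orbit y' y t"
    by (simp add: perturbed_orbit_def orbit_add_right V1 convolve_add_right sum.distrib)
  show "perturbed_orbit (c *\<^sub>R y') y t = c *\<^sub>R perturbed_orbit y' y t"
    by (simp add: perturbed_orbit_def o convolve_cmult_left sum_distrib_left distrib_left)
  show "perturbed_orbit y' (c *\<^sub>R y) t = c *\<^sub>R perturbed_orbit y' y t"
    by (simp add: perturbed_orbit_def orbit_scale_right V1 convolve_cmult_right sum_distrib_left distrib_left)
next
  have "norm (perturbed_orbit y' y t) \<le> norm y' * norm y * (M' * exp ((\<alpha> + 2) * t))" for y' y
    using exp_dominatedD(5)[OF perturbed_orbit_dominated, of y' y t] by (simp add: ac_simps)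
  then show "\<exists>K. \<forall>y' y. norm (perturbed_orbit y' y t) \<le> norm y' * norm y * K" by blast
qed

section \<open>Representability\<close>

lemma laplace_unperturbed:
  assumes "\<omega> < Re \<zeta>"
  shows "laplace S\<^sub>0 \<zeta> (y', 0) (y, 0) = laplace_integral \<zeta> (orbit y' y)"
proof -
  have "\<And>y' y. exp_dominated \<omega> (M * norm y * norm y') (causal (\<lambda>t. S\<^sub>0 t y' y))"
    using orbit_dominated by (simp only: orbit_def)
  from laplace_eq_laplace_integral[OF this assms, where u' = "(y', 0)" and u = "(y, 0)"]
  show ?thesis
    by (simp only: orbit_def[symmetric] fst_conv snd_conv orbit_zero)
      (simp add: laplace_integral_def)
qed

lemma Re_laplace_unperturbed:
  assumes "\<omega> < \<mu>"
  shows "Re (laplace S\<^sub>0 (complex_of_real \<mu>) (y', 0) (y, 0))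
    = (LINT t|lborel. exp (- (\<mu> * t)) * orbit y' y t)"
proof -
  have "laplace S\<^sub>0 (complex_of_real \<mu>) (y', 0) (y, 0)
      = (LINT t|lborel. complex_of_real (exp (- (\<mu> * t)) * orbit y' y t))"
    using laplace_unperturbed[of "complex_of_real \<mu>" y' y] assms
    by (simp add: laplace_integral_def flip: exp_of_real)
  also have "\<dots> = complex_of_real (LINT t|lborel. exp (- (\<mu> * t)) * orbit y' y t)"
    by (rule integral_complex_of_real)
  finally show ?thesis by simp
qed

lemma S0_laplace_represented:
  "\<omega> < Re \<zeta> \<Longrightarrow> represented (complexify_form p) (laplace S\<^sub>0 \<zeta>)"
  using S0_laplace unfolding complex_twin_operator_def by blast

text \<open>Restricting the complex transform to real vectors and a real \<open>\<mu>\<close>, the real part of the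
  representing element represents the real Laplace integral.\<close>

lemma orbits_right: "laplace_representable p (\<lambda>t y'. orbit y' y t) (M * norm y) \<omega>"
proof (rule laplace_representable.intro)
  fix \<mu> assume "\<omega> < \<mu>"
  then obtain z where z: "\<And>u'. complexify_form p u' z = laplace S\<^sub>0 (complex_of_real \<mu>) u' (y, 0)"
    using S0_laplace_represented[of "complex_of_real \<mu>"]
    unfolding represented_def Re_complex_of_real by meson
  have "p y' (fst z) = (LINT t|lborel. exp (- (\<mu> * t)) * orbit y' y t)" for y'
    using arg_cong[OF z[of "(y', 0)"], of Re] \<open>\<omega> < \<mu>\<close>
    by (simp add: complexify_form_real[OF p_bounded_bilinear] Re_laplace_unperturbed)
  then show "\<exists>z. \<forall>y'. p y' z = (LINT t|lborel. exp (- (\<mu> * t)) * orbit y' y t)" by blast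
next
  show "norm z \<le> \<epsilon>" if "0 \<le> \<epsilon>" "\<And>y'. \<bar>p y' z\<bar> \<le> \<epsilon> * norm y'" for z \<epsilon>
    using norming that by (rule norming_norm_le)
qed (use p_bounded_bilinear orbit_dominated M_ge_1 in auto)

lemma orbits_left: "laplace_representable (\<lambda>y y'. p y' y) (\<lambda>t y. orbit y' y t) (M * norm y') \<omega>"
proof (rule laplace_representable.intro)
  show "bounded_bilinear (\<lambda>y y'. p y' y)"
    by (rule bounded_bilinear.flip[OF p_bounded_bilinear])
next
  fix \<mu> assume "\<omega> < \<mu>"
  then obtain z where z: "\<And>u. complexify_form p z u = laplace S\<^sub>0 (complex_of_real \<mu>) (y', 0) u"
    using S0_laplace_represented[of "complex_of_real \<mu>"]
    unfolding represented_def Re_complex_of_real by meson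
  have "p (fst z) y = (LINT t|lborel. exp (- (\<mu> * t)) * orbit y' y t)" for y
    using arg_cong[OF z[of "(y, 0)"], of Re] \<open>\<omega> < \<mu>\<close>
    by (simp add: complexify_form_real[OF p_bounded_bilinear] Re_laplace_unperturbed)
  then show "\<exists>z. \<forall>y. p z y = (LINT t|lborel. exp (- (\<mu> * t)) * orbit y' y t)" by blast
next
  show "norm z \<le> \<epsilon>" if "0 \<le> \<epsilon>" "\<And>y. \<bar>p z y\<bar> \<le> \<epsilon> * norm y" for z \<epsilon>
    using norming_dual_pair_flip[OF norming] that by (rule norming_norm_le)
next
  show "exp_dominated \<omega> (M * norm y' * norm y) (\<lambda>t. orbit y' y t)" for y
    using orbit_dominated[of y y'] by (simp add: ac_simps)
qed (use M_ge_1 in auto)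

text \<open>The weight \<open>s \<mapsto> F (t - s)\<close> vanishes for \<open>s > t\<close>, so it decays faster than any
  exponential; the exponent \<open>\<omega> + 1\<close> is one admissible choice.\<close>

lemma convolution_weight:
  assumes "exp_bounded F" "0 \<le> t"
  obtains B where "\<And>s. 0 \<le> s \<Longrightarrow> \<bar>F (t - s)\<bar> \<le> B * exp (- ((\<omega> + 1) * s))"
proof -
  from assms obtain a A where F: "exp_dominated a A F" by (auto simp: exp_bounded_def)
  have "\<bar>F (t - s)\<bar> \<le> (A * exp (\<bar>a\<bar> * t) * exp (\<bar>\<omega> + 1\<bar> * t)) * exp (- ((\<omega> + 1) * s))" if "0 \<le> s" for s
  proof (cases "s \<le> t")
    case True
    have 1: "exp (a * (t - s)) \<le> exp (\<bar>a\<bar> * t)"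
      using True that by (auto intro!: mult_mono)
    have "(\<omega> + 1) * s \<le> \<bar>\<omega> + 1\<bar> * t" using True that by (intro mult_mono) auto
    then have 2: "1 \<le> exp (\<bar>\<omega> + 1\<bar> * t) * exp (- ((\<omega> + 1) * s))"
      by (simp flip: exp_add)
    have "\<bar>F (t - s)\<bar> \<le> A * exp (a * (t - s)) * 1"
      using exp_dominatedD(5)[OF F, of "t - s"] by simp
    also have "\<dots> \<le> (A * exp (\<bar>a\<bar> * t)) * (exp (\<bar>\<omega> + 1\<bar> * t) * exp (- ((\<omega> + 1) * s)))"
      using 1 2 exp_dominatedD(4)[OF F] by (intro mult_mono) auto
    finally show ?thesis by (simp add: mult.assoc)
  next
    case False
    then show ?thesis using exp_dominatedD(2,4)[OF F] by simp
  qed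
  then show thesis by (rule that)
qed

lemma convolution_represented_right:
  assumes F: "exp_bounded F" and "0 \<le> t"
  shows "\<exists>z. \<forall>y'. p y' z = (orbit y' y \<star> F) t"
proof -
  obtain B where B: "\<And>s. 0 \<le> s \<Longrightarrow> \<bar>F (t - s)\<bar> \<le> B * exp (- ((\<omega> + 1) * s))"
    using convolution_weight[OF assms] by blast
  have [measurable]: "F \<in> borel_measurable borel" using exp_boundedD[OF F] by simp
  have "\<exists>z. \<forall>y'. p y' z = (LINT s|lborel. F (t - s) * orbit y' y s)"
    by (rule laplace_representable.weak_integral_representable[OF orbits_right _ B]) auto
  then show ?thesis by (simp add: convolve_commute[of _ F] convolve_def)
qed

lemma convolution_represented_left:
  assumes F: "exp_bounded F" and "0 \<le> t"
  shows "\<exists>z'. \<forall>y. p z' y = (F \<star> orbit y' y) t"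
proof -
  obtain B where B: "\<And>s. 0 \<le> s \<Longrightarrow> \<bar>F (t - s)\<bar> \<le> B * exp (- ((\<omega> + 1) * s))"
    using convolution_weight[OF assms] by blast
  have [measurable]: "F \<in> borel_measurable borel" using exp_boundedD[OF F] by simp
  have "\<exists>z'. \<forall>y. p z' y = (LINT s|lborel. F (t - s) * orbit y' y s)"
    by (rule laplace_representable.weak_integral_representable[OF orbits_left _ B]) auto
  then show ?thesis by (simp add: convolve_def)
qed

text \<open>For fixed \<open>y\<close> the first formula exhibits the perturbed family as convolutions of orbits of
  the \<open>q j\<close> with scalar functions, for fixed \<open>y'\<close> the second one as convolutions of orbits of
  the \<open>q' j\<close> with scalar functions.\<close>

lemma perturbed_orbit_represented:
  assumes "0 \<le> t"
  shows "represented p (\<lambda>y' y. perturbed_orbit y' y t)"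
  unfolding represented_def
proof (intro conjI allI)
  fix y
  obtain z where z: "\<And>y'. p y' z = S\<^sub>0 t y' y"
    using S0_represented[OF assms] unfolding represented_def by meson
  have "\<forall>j. \<exists>x. \<forall>y'. p y' x = (orbit y' (q j) \<star> V j y) t"
    using assms by (auto intro: convolution_represented_right)
  then obtain x where x: "\<And>j y'. p y' (x j) = (orbit y' (q j) \<star> V j y) t" by metis
  have "p y' (z + (\<Sum>j\<in>UNIV. x j)) = perturbed_orbit y' y t" for y'
    using assms by (simp add: bounded_bilinear.add_right[OF p_bounded_bilinear]
        bounded_bilinear.sum_right[OF p_bounded_bilinear] z x perturbed_orbit_def orbit_def[of y' y])
  then show "\<exists>z. \<forall>y'. p y' z = perturbed_orbit y' y t" by blast
next
  fix y'
  obtain z where z: "\<And>y. p z y = S\<^sub>0 t y' y"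
    using S0_represented[OF assms] unfolding represented_def by meson
  have "\<forall>j. \<exists>x. \<forall>y. p x y = (W j y' \<star> orbit (q' j) y) t"
    using assms by (auto intro: convolution_represented_left)
  then obtain x where x: "\<And>j y. p (x j) y = (W j y' \<star> orbit (q' j) y) t" by metis
  have "p (z + (\<Sum>j\<in>UNIV. x j)) y = perturbed_orbit y' y t" for y
    using assms by (simp add: bounded_bilinear.add_left[OF p_bounded_bilinear]
        bounded_bilinear.sum_left[OF p_bounded_bilinear] z x perturbed_orbit_eq_W orbit_def[of y' y])
  then show "\<exists>z. \<forall>y. p z y = perturbed_orbit y' y t" by blast
qed

section \<open>The semigroup law\<close>

lemma translate_orbit:
  assumes "0 \<le> t" and z': "\<And>x. p z' x = S\<^sub>0 t y' x"
  shows "translate t (orbit y' y) = orbit z' y"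
proof
  fix u
  show "translate t (orbit y' y) u = orbit z' y u"
  proof (cases "0 \<le> u")
    case True
    have "S\<^sub>0 (t + u) y' y = S\<^sub>0 u z' y"
      unfolding S0_plus[OF \<open>0 \<le> t\<close> True]
      by (rule twin_comp_eq_left[OF norming S0_represented[OF True]]) (rule z')
    then show ?thesis using assms True by (simp add: translate_def orbit_def add.commute)
  qed (simp add: translate_def)
qed

text \<open>\<open>convolve_plus\<close> splits \<open>{0..t+s}\<close> at \<open>s\<close>. On the part before \<open>s\<close> the unperturbed
  semigroup law moves the remaining time \<open>t\<close> to the functional, \<open>z' = y'S\<^sub>0(t)\<close>, and what is
  left is the perturbed orbit of \<open>z'\<close> at time \<open>s\<close>, that is, \<open>S\<^sub>0(t)\<close> acting on
  \<open>z = S(s)y\<close>.\<close>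

lemma perturbed_orbit_restart:
  assumes ts: "0 \<le> t" "0 \<le> s" and z: "\<And>x'. p x' z = perturbed_orbit x' y s"
  shows "perturbed_orbit y' y (t + s)
      = orbit y' z t + (\<Sum>j\<in>UNIV. (orbit y' (q j) \<star> translate s (V j y)) t)"
proof -
  obtain z' where z': "\<And>x. p z' x = S\<^sub>0 t y' x"
    using S0_represented[OF ts(1)] unfolding represented_def by meson
  have "orbit y' y (t + s) = translate t (orbit y' y) s"
    using ts by (simp add: translate_def add.commute)
  then have o: "orbit y' y (t + s) = orbit z' y s"
    by (simp add: translate_orbit[OF ts(1) z'])
  have "(orbit y' (q j) \<star> V j y) (t + s)
      = (orbit z' (q j) \<star> V j y) s + (orbit y' (q j) \<star> translate s (V j y)) t" for j
    using ts by (subst convolve_plus) (auto simp: translate_orbit[OF ts(1) z'])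
  then have "perturbed_orbit y' y (t + s)
      = perturbed_orbit z' y s + (\<Sum>j\<in>UNIV. (orbit y' (q j) \<star> translate s (V j y)) t)"
    by (simp add: perturbed_orbit_def o sum.distrib)
  also have "perturbed_orbit z' y s = orbit y' z t"
    using z[of z'] z'[of z] ts by (simp add: orbit_def)
  finally show ?thesis .
qed

text \<open>By \<open>perturbed_orbit_restart\<close> with \<open>y' = q' i\<close>, the translate solves the renewal equation
  with initial vector \<open>z\<close>.\<close>

lemma translate_V:
  assumes "0 \<le> s" and z: "\<And>x'. p x' z = perturbed_orbit x' y s"
  shows "translate s (V i y) = V i z"
proof -
  have *: "translate s (V i y) t
      = orbit (q' i) z t + (\<Sum>j\<in>UNIV. (K i j \<star> translate s (V j y)) t)" for i t
  proof (cases "0 \<le> t")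
    case True
    then show ?thesis
      using perturbed_orbit_restart[OF True \<open>0 \<le> s\<close> z, of "q' i"]
      by (simp add: translate_def V_eq_perturbed_orbit)
  next
    case False
    then have "(K i j \<star> translate s (V j y)) t = 0" for j
      by (intro convolve_neg) (auto simp: translate_def)
    with False show ?thesis by (simp add: translate_def)
  qed
  have "translate s (V i y) t = orbit (q' i) z t + (\<Sum>j\<in>UNIV. (R i j \<star> orbit (q' j) z) t)" for t
    using \<open>0 \<le> s\<close>
    by (intro renewal_unique[where U = "\<lambda>i. translate s (V i y)" and H = "\<lambda>i. orbit (q' i) z"] *)
      (auto intro: exp_bounded_translate)
  then show ?thesis by (simp add: fun_eq_iff V_def)
qed

lemma perturbed_orbit_plus:
  assumes "0 \<le> t" "0 \<le> s" and z: "\<And>x'. p x' z = perturbed_orbit x' y s"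
  shows "perturbed_orbit y' y (t + s) = perturbed_orbit y' z t"
  using perturbed_orbit_restart[OF assms] translate_V[OF assms(2) z]
  by (simp add: perturbed_orbit_def)

end

section \<open>Laplace transform and generator\<close>

text \<open>The hypothesis on \<open>D\<close> says \<open>D (I - k) = I\<close>.\<close>

lemma resolvent_matrix_unique:
  fixes k D :: "'n::finite \<Rightarrow> 'n \<Rightarrow> complex"
  assumes D: "\<And>i j. D i j = (if i = j then 1 else 0) + (\<Sum>l\<in>UNIV. D i l * k l j)"
    and a: "\<And>i. a i = b i + (\<Sum>j\<in>UNIV. k i j * a j)"
  shows "a i = (\<Sum>j\<in>UNIV. D i j * b j)"
proof -
  have b: "b j = a j - (\<Sum>l\<in>UNIV. k j l * a l)" for j using a[of j] by simp
  have "(\<Sum>j\<in>UNIV. D i j * b j)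
      = (\<Sum>j\<in>UNIV. D i j * a j) - (\<Sum>j\<in>UNIV. \<Sum>l\<in>UNIV. D i j * k j l * a l)"
    unfolding b by (simp add: right_diff_distrib sum_subtractf sum_distrib_left mult.assoc)
  also have "(\<Sum>j\<in>UNIV. \<Sum>l\<in>UNIV. D i j * k j l * a l)
      = (\<Sum>l\<in>UNIV. (D i l - (if i = l then 1 else 0)) * a l)"
    by (subst sum.swap) (subst D, simp add: sum_distrib_right)
  also have "\<dots> = (\<Sum>l\<in>UNIV. D i l * a l) - a i"
    by (simp add: left_diff_distrib sum_subtractf if_distrib[of "\<lambda>x. x * _"] cong: if_cong)
  finally show ?thesis by simp
qed

lemma bounded_bilinear_plus:
  assumes "bounded_bilinear f" "bounded_bilinear g"
  shows "bounded_bilinear (\<lambda>x y. f x y + g x y)"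
proof -
  interpret f: bounded_bilinear f by fact
  interpret g: bounded_bilinear g by fact
  from f.bounded g.bounded obtain A B where "\<And>x y. norm (f x y) \<le> norm x * norm y * A"
    "\<And>x y. norm (g x y) \<le> norm x * norm y * B" by blast
  then have "norm (f x y + g x y) \<le> norm x * norm y * (A + B)" for x y
    by (simp add: distrib_left norm_triangle_mono)
  then have "\<exists>K. \<forall>x y. norm (f x y + g x y) \<le> norm x * norm y * K" by blast
  then show ?thesis
    by (intro bounded_bilinear.intro)
      (auto simp: f.add_left f.add_right g.add_left g.add_right f.scaleR_left f.scaleR_right
        g.scaleR_left g.scaleR_right scaleR_add_right)
qed

lemma bounded_bilinear_finite_sum:
  assumes "finite I" "\<And>i. i \<in> I \<Longrightarrow> bounded_bilinear (f i)"
  shows "bounded_bilinear (\<lambda>x y. \<Sum>i\<in>I. f i x y)"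
  using assms
proof (induction I rule: finite_induct)
  case empty
  show ?case by (rule bounded_bilinear.intro) (auto intro: exI[of _ 0])
next
  case (insert i I)
  then show ?case by (simp add: bounded_bilinear_plus)
qed

context twin_perturbation
begin

abbreviation S :: "real \<Rightarrow> 'b \<Rightarrow> 'a \<Rightarrow> real" where
  "S \<equiv> pert_semigroup S\<^sub>0 q q' r"

lemma causal_S: "causal (\<lambda>t. S t y' y) = perturbed_orbit y' y"
proof
  fix t
  show "causal (\<lambda>t. S t y' y) t = perturbed_orbit y' y t"
    using exp_boundedD(2)[OF perturbed_orbit_exp_bounded, of t y' y]
    by (cases "0 \<le> t") (simp_all add: pert_semigroup_eq)
qed

text \<open>The transform of \<open>\<delta> + r\<close>. The resolvent equations become \<open>D = I + k D = I + D k\<close>, so this is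
  the inverse of \<open>I - k\<close>, where \<open>k\<close> is the transformed kernel.\<close>

definition D :: "complex \<Rightarrow> 'n \<Rightarrow> 'n \<Rightarrow> complex" where
  "D \<zeta> i j = (if i = j then 1 else 0) + laplace_integral \<zeta> (R i j)"

lemma
  assumes "\<alpha> < Re \<zeta>"
  defines "k \<equiv> \<lambda>i j. laplace_integral \<zeta> (K i j)"
  shows D_right: "D \<zeta> i j = (if i = j then 1 else 0) + (\<Sum>l\<in>UNIV. k i l * D \<zeta> l j)"
    and D_left: "D \<zeta> i j = (if i = j then 1 else 0) + (\<Sum>l\<in>UNIV. D \<zeta> i l * k l j)"
proof -
  let ?r = "\<lambda>i j. laplace_integral \<zeta> (R i j)"
  have \<omega>: "\<omega> < Re \<zeta>" using omega_less_alpha assms(1) by simp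
  have KR: "exp_dominated \<alpha> (\<kappa> * (2 * \<kappa>) / (\<alpha> - \<omega>)) (K a b \<star> R c d)" for a b c d
    by (rule convolve_bound[OF K_dominated R_dominated omega_less_alpha])
  then have RK: "exp_dominated \<alpha> (\<kappa> * (2 * \<kappa>) / (\<alpha> - \<omega>)) (R a b \<star> K c d)" for a b c d
    by (simp add: convolve_commute[of "R a b"])
  have "R i j = (\<lambda>t. K i j t + (\<Sum>l\<in>UNIV. (K i l \<star> R l j) t))"
    using resolvent_right by auto
  then have "?r i j = laplace_integral \<zeta> (\<lambda>t. K i j t + (\<Sum>l\<in>UNIV. (K i l \<star> R l j) t))"
    by (rule arg_cong)
  also have "\<dots> = k i j + (\<Sum>l\<in>UNIV. k i l * ?r l j)"
    unfolding k_def
    by (subst laplace_integral_add[OF K_dominated exp_dominated_sum[OF KR] \<omega> assms(1)])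
      (simp add: laplace_integral_sum[OF KR assms(1)]
        laplace_integral_convolve[OF K_dominated R_dominated \<omega> assms(1)])
  finally show "D \<zeta> i j = (if i = j then 1 else 0) + (\<Sum>l\<in>UNIV. k i l * D \<zeta> l j)"
    by (simp add: D_def distrib_left sum.distrib if_distrib[of "\<lambda>x. _ * x"] cong: if_cong)
  have "R i j = (\<lambda>t. K i j t + (\<Sum>l\<in>UNIV. (R i l \<star> K l j) t))"
    using resolvent_left by auto
  then have "?r i j = laplace_integral \<zeta> (\<lambda>t. K i j t + (\<Sum>l\<in>UNIV. (R i l \<star> K l j) t))"
    by (rule arg_cong)
  also have "\<dots> = k i j + (\<Sum>l\<in>UNIV. ?r i l * k l j)"
    unfolding k_def
    by (subst laplace_integral_add[OF K_dominated exp_dominated_sum[OF RK] \<omega> assms(1)])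
      (simp add: laplace_integral_sum[OF RK assms(1)]
        laplace_integral_convolve[OF R_dominated K_dominated assms(1) \<omega>])
  finally show "D \<zeta> i j = (if i = j then 1 else 0) + (\<Sum>l\<in>UNIV. D \<zeta> i l * k l j)"
    by (simp add: D_def distrib_right sum.distrib if_distrib[of "\<lambda>x. x * _"] cong: if_cong)
qed

lemma laplace_V:
  assumes "\<alpha> < Re \<zeta>"
  shows "laplace_integral \<zeta> (V i y)
    = (\<Sum>j\<in>UNIV. D \<zeta> i j * laplace_integral \<zeta> (orbit (q' j) y))"
proof -
  have \<omega>: "\<omega> < Re \<zeta>" using omega_less_alpha assms by simp
  have Rh: "exp_dominated \<alpha> (M * norm y * norm (q' j) * (2 * \<kappa>) / (\<alpha> - \<omega>)) (R i j \<star> orbit (q' j) y)"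
    for j
    using convolve_bound[OF orbit_dominated R_dominated omega_less_alpha]
    by (subst convolve_commute)
  have "laplace_integral \<zeta> (V i y)
      = laplace_integral \<zeta> (\<lambda>t. orbit (q' i) y t + (\<Sum>j\<in>UNIV. (R i j \<star> orbit (q' j) y) t))"
    by (simp add: V_def[abs_def])
  also have "\<dots> = laplace_integral \<zeta> (orbit (q' i) y)
      + (\<Sum>j\<in>UNIV. laplace_integral \<zeta> (R i j) * laplace_integral \<zeta> (orbit (q' j) y))"
    by (subst laplace_integral_add[OF orbit_dominated exp_dominated_sum[OF Rh] \<omega> assms])
      (simp add: laplace_integral_sum[OF Rh assms]
        laplace_integral_convolve[OF R_dominated orbit_dominated assms \<omega>])
  finally show ?thesis
    by (simp add: D_def distrib_right sum.distrib if_distrib[of "\<lambda>x. x * _"] cong: if_cong)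
qed

lemma laplace_perturbed_orbit:
  assumes "\<alpha> + 2 < Re \<zeta>"
  defines "l \<equiv> \<lambda>y' y. laplace_integral \<zeta> (orbit y' y)"
  shows "laplace_integral \<zeta> (perturbed_orbit y' y)
    = l y' y + (\<Sum>i\<in>UNIV. \<Sum>j\<in>UNIV. l y' (q i) * D \<zeta> i j * l (q' j) y)"
proof -
  have \<zeta>: "\<omega> < Re \<zeta>" "\<alpha> < Re \<zeta>" "\<alpha> + 1 < Re \<zeta>" "\<omega> < \<alpha> + 1"
    using omega_less_alpha assms(1) by simp_all
  have gV: "exp_dominated (\<alpha> + 1) (M * norm (q i) * norm y' * (\<nu> i * norm y) / (\<alpha> + 1 - \<omega>))
      (orbit y' (q i) \<star> V i y)" for i
    by (rule convolve_bound[OF orbit_dominated V_dominated \<zeta>(4)])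
  have "laplace_integral \<zeta> (perturbed_orbit y' y)
      = laplace_integral \<zeta> (\<lambda>t. orbit y' y t + (\<Sum>i\<in>UNIV. (orbit y' (q i) \<star> V i y) t))"
    by (simp add: perturbed_orbit_def[abs_def])
  also have "\<dots> = l y' y + (\<Sum>i\<in>UNIV. l y' (q i) * laplace_integral \<zeta> (V i y))"
    unfolding l_def
    by (subst laplace_integral_add[OF orbit_dominated exp_dominated_sum[OF gV] \<zeta>(1,3)])
      (simp add: laplace_integral_sum[OF gV \<zeta>(3)]
        laplace_integral_convolve[OF orbit_dominated V_dominated \<zeta>(1,3)])
  finally show ?thesis
    by (simp add: laplace_V[OF \<zeta>(2)] l_def sum_distrib_left mult.assoc)
qed

text \<open>Complexification commutes with a finite rank correction by products of scalar transforms, so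
  the identity on real vectors carries over to the complexified spaces. It also shows at once
  that the transform is bounded, complex bilinear and represented on both sides.\<close>

lemma laplace_perturbed:
  assumes "\<alpha> + 2 < Re \<zeta>"
  shows "laplace S \<zeta> u' u = laplace S\<^sub>0 \<zeta> u' u
    + (\<Sum>i\<in>UNIV. \<Sum>j\<in>UNIV. laplace S\<^sub>0 \<zeta> u' (q i, 0) * D \<zeta> i j * laplace S\<^sub>0 \<zeta> (q' j, 0) u)"
proof -
  let ?l = "\<lambda>y' y. laplace_integral \<zeta> (orbit y' y)"
  let ?D = "\<lambda>i j. D \<zeta> i j"
  have \<omega>: "\<omega> < Re \<zeta>" using omega_less_alpha assms by simp
  have "exp_dominated \<omega> (M * norm y * norm y') (causal (\<lambda>t. S\<^sub>0 t y' y))" for y' y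
    using orbit_dominated by (simp only: orbit_def)
  from laplace_eq_laplace_integral[OF this \<omega>]
  have L0: "laplace S\<^sub>0 \<zeta> u' u = ?l (fst u') (fst u) - ?l (snd u') (snd u)
      + \<i> * (?l (fst u') (snd u) + ?l (snd u') (fst u))" for u' u
    by (simp only: orbit_def[symmetric])
  have "exp_dominated (\<alpha> + 2) (M' * norm y * norm y') (causal (\<lambda>t. S t y' y))" for y' y
    using perturbed_orbit_dominated by (simp only: causal_S)
  note L = laplace_eq_laplace_integral[OF this assms, unfolded causal_S laplace_perturbed_orbit[OF assms]]
  have zero: "?l y' 0 = 0" "?l 0 y = 0" for y' y
    by (simp_all add: orbit_zero laplace_integral_def)
  have alg: "(a + \<i> * a') * d * (b + \<i> * b')
      = a * d * b - a' * d * b' + \<i> * (a * d * b' + a' * d * b)" for a a' b b' d :: complex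
    by (simp add: algebra_simps)
  have "(\<Sum>i\<in>UNIV. \<Sum>j\<in>UNIV. laplace S\<^sub>0 \<zeta> u' (q i, 0) * ?D i j * laplace S\<^sub>0 \<zeta> (q' j, 0) u)
      = (\<Sum>i\<in>UNIV. \<Sum>j\<in>UNIV. (?l (fst u') (q i) + \<i> * ?l (snd u') (q i)) * ?D i j *
          (?l (q' j) (fst u) + \<i> * ?l (q' j) (snd u)))"
    by (simp add: L0 zero)
  also have "\<dots> = (\<Sum>i\<in>UNIV. \<Sum>j\<in>UNIV. ?l (fst u') (q i) * ?D i j * ?l (q' j) (fst u))
      - (\<Sum>i\<in>UNIV. \<Sum>j\<in>UNIV. ?l (snd u') (q i) * ?D i j * ?l (q' j) (snd u))
      + \<i> * ((\<Sum>i\<in>UNIV. \<Sum>j\<in>UNIV. ?l (fst u') (q i) * ?D i j * ?l (q' j) (snd u))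
        + (\<Sum>i\<in>UNIV. \<Sum>j\<in>UNIV. ?l (snd u') (q i) * ?D i j * ?l (q' j) (fst u)))"
    unfolding alg sum.distrib sum_subtractf sum_distrib_left[symmetric] by simp
  finally show ?thesis
    by (simp only: L L0[of u' u] distrib_left) (simp add: algebra_simps)
qed

lemma S0_laplace_twin:
  assumes "\<omega> < Re \<zeta>"
  shows "bounded_bilinear (laplace S\<^sub>0 \<zeta>)"
    and "laplace S\<^sub>0 \<zeta> (cscale c u') u = c * laplace S\<^sub>0 \<zeta> u' u"
    and "laplace S\<^sub>0 \<zeta> u' (cscale c u) = c * laplace S\<^sub>0 \<zeta> u' u"
  using S0_laplace[OF assms] unfolding complex_twin_operator_def by blast+

lemma complex_twin_laplace:
  assumes "\<alpha> + 2 < Re \<zeta>"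
  shows "complex_twin_operator p (laplace S \<zeta>)"
proof -
  have \<omega>: "\<omega> < Re \<zeta>" using omega_less_alpha assms by simp
  note L0 = S0_laplace_twin[OF \<omega>]
  let ?L = "laplace S\<^sub>0 \<zeta>"
  note cp = complexify_form_bounded_bilinear[OF p_bounded_bilinear]
    complexify_form_cscale[OF p_bounded_bilinear]
  have "bounded_bilinear (\<lambda>u' u. ?L u' (q i, 0) * D \<zeta> i j * ?L (q' j, 0) u)" for i j
    by (intro bounded_bilinear.comp[OF bounded_bilinear_mult]
        bounded_linear_mult_left[THEN bounded_linear_compose]
        bounded_bilinear.bounded_linear_left[OF L0(1)] bounded_bilinear.bounded_linear_right[OF L0(1)])
  then have "bounded_bilinear (laplace S \<zeta>)"
    unfolding laplace_perturbed[OF assms, abs_def]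
    by (intro bounded_bilinear_plus bounded_bilinear_finite_sum L0(1)) auto
  moreover have "laplace S \<zeta> (cscale c u') u = c * laplace S \<zeta> u' u"
    "laplace S \<zeta> u' (cscale c u) = c * laplace S \<zeta> u' u" for c u' u
    by (simp_all add: laplace_perturbed[OF assms] L0(2,3) distrib_left sum_distrib_left ac_simps)
  moreover have "represented (complexify_form p) (laplace S \<zeta>)"
    unfolding represented_def
  proof (intro conjI allI)
    fix u
    obtain z where z: "\<And>v u'. complexify_form p u' (z v) = ?L u' v"
      using S0_laplace_represented[OF \<omega>] unfolding represented_def by metis
    have "complexify_form p u' (z u + (\<Sum>i\<in>UNIV. \<Sum>j\<in>UNIV.
        cscale (D \<zeta> i j * ?L (q' j, 0) u) (z (q i, 0)))) = laplace S \<zeta> u' u" for u'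
      by (simp add: bounded_bilinear.add_right[OF cp(1)] bounded_bilinear.sum_right[OF cp(1)] cp(3)
          z laplace_perturbed[OF assms] ac_simps)
    then show "\<exists>z. \<forall>u'. complexify_form p u' z = laplace S \<zeta> u' u" by blast
  next
    fix u'
    obtain z where z: "\<And>v u. complexify_form p (z v) u = ?L v u"
      using S0_laplace_represented[OF \<omega>] unfolding represented_def by metis
    have "complexify_form p (z u' + (\<Sum>i\<in>UNIV. \<Sum>j\<in>UNIV.
        cscale (?L u' (q i, 0) * D \<zeta> i j) (z (q' j, 0)))) u = laplace S \<zeta> u' u" for u
      by (simp add: bounded_bilinear.add_left[OF cp(1)] bounded_bilinear.sum_left[OF cp(1)] cp(2)
          z laplace_perturbed[OF assms])
    then show "\<exists>z'. \<forall>u. complexify_form p z' u = laplace S \<zeta> u' u" by blast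
  qed
  ultimately show ?thesis unfolding complex_twin_operator_def by blast
qed

lemma twin_semigroup_perturbed: "twin_semigroup_with M' (\<alpha> + 2) p S"
  unfolding twin_semigroup_with_def
proof (intro conjI allI impI)
  have S: "S t = (\<lambda>y' y. perturbed_orbit y' y t)" if "0 \<le> t" for t
    using that by (simp add: fun_eq_iff pert_semigroup_eq)
  show "twin_operator p (S t)" if "0 \<le> t" for t
    using that by (simp add: S twin_operator_def perturbed_orbit_bounded_bilinear
        perturbed_orbit_represented)
  show "S 0 = p"
  proof (intro ext)
    fix y' y
    have "(orbit y' (q j) \<star> V j y) 0 = 0" for j
      by (rule convolve_0) (auto simp: exp_boundedD(2)[OF V_exp_bounded])
    then show "S 0 y' y = p y' y"
      by (simp add: pert_semigroup_eq perturbed_orbit_def) (simp add: orbit_def S0_zero)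
  qed
  show "S (t + s) = twin_comp p (S t) (S s)" if ts: "0 \<le> t" "0 \<le> s" for t s
  proof (intro ext)
    fix y' y
    obtain z where z: "\<And>x'. p x' z = perturbed_orbit x' y s"
      using perturbed_orbit_represented[OF ts(2)] unfolding represented_def by meson
    have "S (t + s) y' y = S t y' z"
      using ts z by (simp add: pert_semigroup_eq perturbed_orbit_plus)
    also have "\<dots> = twin_comp p (S t) (S s) y' y"
      using ts z perturbed_orbit_represented[OF ts(1)]
      by (intro twin_comp_eq_right[OF norming, symmetric]) (auto simp: S)
    finally show "S (t + s) y' y = twin_comp p (S t) (S s) y' y" .
  qed
  show "1 \<le> M'" by (simp add: M'_def)
  show "\<bar>S t y' y\<bar> \<le> M' * exp ((\<alpha> + 2) * t) * norm y * norm y'" if "0 \<le> t" for t y' y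
    using exp_dominatedD(5)[OF perturbed_orbit_dominated, of y' y t] that
    by (simp add: pert_semigroup_eq ac_simps)
  show "(\<lambda>t. S t y' y) \<in> borel_measurable (restrict_space borel {0..})" for y' y
  proof -
    have "perturbed_orbit y' y \<in> borel_measurable (restrict_space borel {0..})"
      by (intro measurable_restrict_space1 exp_boundedD perturbed_orbit_exp_bounded)
    also have "perturbed_orbit y' y \<in> borel_measurable (restrict_space borel {0..})
        \<longleftrightarrow> (\<lambda>t. S t y' y) \<in> borel_measurable (restrict_space borel {0..})"
      by (rule measurable_cong) (simp add: space_restrict_space pert_semigroup_eq)
    finally show ?thesis .
  qed
  show "complex_twin_operator p (laplace S \<zeta>)" if "\<alpha> + 2 < Re \<zeta>" for \<zeta>
    using that by (rule complex_twin_laplace)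
qed

lemma act_right_complex_iff:
  assumes "represented (complexify_form p) L"
  shows "y = act_right (complexify_form p) L x \<longleftrightarrow> (\<forall>u'. complexify_form p u' y = L u' x)"
proof -
  obtain z where z: "\<And>u'. complexify_form p u' z = L u' x"
    using assms unfolding represented_def by meson
  have "act_right (complexify_form p) L x = z"
    using norming z by (rule complexify_act_right)
  then show ?thesis
    using z complexify_eq_right[OF norming, of y z] by auto
qed

text \<open>Pairing either equation with \<open>(q' i, 0)\<close> gives a linear system for the numbers
  \<open>a i = \<langle>q' i, y\<rangle>\<close>, and both systems have the solution \<open>a = D b\<close> with
  \<open>b i = \<langle>q' i, L\<^sub>0 x\<rangle>\<close>. For these values the two equations coincide.\<close>

lemma perturbed_resolvent_iff:
  assumes "\<alpha> + 2 < Re \<zeta>"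
  defines "e \<equiv> \<lambda>u. (\<Sum>j\<in>UNIV. cscale (complexify_form p (q' j, 0) u) (q j, 0))"
  shows "y = act_right (complexify_form p) (laplace S \<zeta>) x
    \<longleftrightarrow> y = act_right (complexify_form p) (laplace S\<^sub>0 \<zeta>) (x + e y)"
proof -
  have \<omega>: "\<omega> < Re \<zeta>" and \<alpha>: "\<alpha> < Re \<zeta>" using omega_less_alpha assms(1) by simp_all
  let ?L = "laplace S\<^sub>0 \<zeta>"
  note L0 = S0_laplace_twin[OF \<omega>]
  define a where "a j = complexify_form p (q' j, 0) y" for j
  define b where "b j = ?L (q' j, 0) x" for j
  define k where "k i j = ?L (q' i, 0) (q j, 0)" for i j
  have k: "laplace_integral \<zeta> (K i j) = k i j" for i j
    by (simp add: k_def laplace_unperturbed[OF \<omega>])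
  have Le: "?L u' (x + e y) = ?L u' x + (\<Sum>j\<in>UNIV. ?L u' (q j, 0) * a j)" for u'
    by (simp add: e_def bounded_bilinear.add_right[OF L0(1)] bounded_bilinear.sum_right[OF L0(1)]
        L0(3) a_def mult.commute)
  have LS: "laplace S \<zeta> u' x
      = ?L u' x + (\<Sum>i\<in>UNIV. ?L u' (q i, 0) * (\<Sum>j\<in>UNIV. D \<zeta> i j * b j))" for u'
    by (simp add: laplace_perturbed[OF assms(1)] b_def sum_distrib_left mult.assoc)
  have "(\<forall>u'. complexify_form p u' y = laplace S \<zeta> u' x)
      \<longleftrightarrow> (\<forall>u'. complexify_form p u' y = ?L u' (x + e y))"
  proof
    assume *: "\<forall>u'. complexify_form p u' y = laplace S \<zeta> u' x"
    have "a i = (\<Sum>j\<in>UNIV. D \<zeta> i j * b j)" for i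
    proof -
      have "a i = b i + (\<Sum>m\<in>UNIV. k i m * (\<Sum>j\<in>UNIV. D \<zeta> m j * b j))"
        using * LS[of "(q' i, 0)"] by (simp add: a_def b_def k_def)
      also have "(\<Sum>m\<in>UNIV. k i m * (\<Sum>j\<in>UNIV. D \<zeta> m j * b j))
          = (\<Sum>j\<in>UNIV. (\<Sum>m\<in>UNIV. k i m * D \<zeta> m j) * b j)"
        unfolding sum_distrib_left sum_distrib_right by (subst sum.swap) (simp add: mult.assoc)
      also have "\<dots> = (\<Sum>j\<in>UNIV. (D \<zeta> i j - (if i = j then 1 else 0)) * b j)"
        by (subst D_right[OF \<alpha>]) (simp add: k)
      also have "\<dots> = (\<Sum>j\<in>UNIV. D \<zeta> i j * b j) - b i"
        by (simp add: left_diff_distrib sum_subtractf if_distrib[of "\<lambda>x. x * _"] cong: if_cong)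
      finally show ?thesis by simp
    qed
    with * LS Le show "\<forall>u'. complexify_form p u' y = ?L u' (x + e y)" by simp
  next
    assume *: "\<forall>u'. complexify_form p u' y = ?L u' (x + e y)"
    have "a i = (\<Sum>j\<in>UNIV. D \<zeta> i j * b j)" for i
    proof (rule resolvent_matrix_unique)
      show "D \<zeta> i j = (if i = j then 1 else 0) + (\<Sum>l\<in>UNIV. D \<zeta> i l * k l j)" for i j
        using D_left[OF \<alpha>, of i j] by (simp only: k)
      show "a i = b i + (\<Sum>j\<in>UNIV. k i j * a j)" for i
        using * Le[of "(q' i, 0)"] by (simp add: a_def b_def k_def)
    qed
    with * LS Le show "\<forall>u'. complexify_form p u' y = laplace S \<zeta> u' x" by simp
  qed
  moreover have "represented (complexify_form p) (laplace S \<zeta>)"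
    using complex_twin_laplace[OF assms(1)] unfolding complex_twin_operator_def by blast
  ultimately show ?thesis
    using S0_laplace_represented[OF \<omega>] by (simp add: act_right_complex_iff)
qed

end

theorem theorem6p1:
  fixes p :: "'b::banach \<Rightarrow> 'a::banach \<Rightarrow> real"
    and S\<^sub>0 :: "real \<Rightarrow> 'b \<Rightarrow> 'a \<Rightarrow> real"
    and C\<^sub>0 :: "('a \<times> 'a) set"
    and q :: "'n::finite \<Rightarrow> 'a"
    and q' :: "'n \<Rightarrow> 'b"
    and r :: "real \<Rightarrow> real^'n^'n"
  assumes "norming_dual_pair p"
    and "suitable_for_twin_perturbation p"
    and "twin_semigroup p S\<^sub>0"
    and "is_twin_generator p S\<^sub>0 C\<^sub>0"
    and "is_resolvent (pert_kernel S\<^sub>0 q q') r"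
  shows "(\<forall>t\<ge>0. pert_semigroup S\<^sub>0 q q' r t = pert_semigroup' S\<^sub>0 q q' r t) \<and>
    twin_semigroup p (pert_semigroup S\<^sub>0 q q' r) \<and>
    (\<exists>C. is_twin_generator p (pert_semigroup S\<^sub>0 q q' r) C \<and>
       Domain C = Domain C\<^sub>0 \<and>
       (\<forall>y. C `` {y} = {z + (\<Sum>j\<in>UNIV. p (q' j) y *\<^sub>R q j) | z. z \<in> C\<^sub>0 `` {y}}))"
proof -
  obtain M \<omega> where semigroup: "twin_semigroup_with M \<omega> p S\<^sub>0" and C0: "subspace C\<^sub>0"
    and gen: "\<And>\<zeta> y z. \<omega> < Re \<zeta> \<Longrightarrow> (y, z) \<in> complexify_rel C\<^sub>0 \<longleftrightarrow>
      y = act_right (complexify_form p) (laplace S\<^sub>0 \<zeta>) (cscale \<zeta> y - z)"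
    using assms(4) unfolding is_twin_generator_def by blast
  interpret twin_perturbation p S\<^sub>0 q q' r M \<omega>
    by unfold_locales (fact assms(1) semigroup assms(5))+
  \<comment> \<open>The image of the old graph under the shear \<open>(y, z) \<mapsto> (y, z + f y)\<close> is the new graph.\<close>
  define f where "f y = (\<Sum>j\<in>UNIV. p (q' j) y *\<^sub>R q j)" for y
  define C where "C = (\<lambda>(y, z). (y, z + f y)) ` C\<^sub>0"
  have C_iff: "(y, w) \<in> C \<longleftrightarrow> (y, w - f y) \<in> C\<^sub>0" for y w
    by (auto simp: C_def image_iff) force
  have lin: "linear f"
    unfolding f_def
    by (intro linear_compose_sum ballI bounded_linear.linear bounded_linear_scaleR_left
      bounded_linear_compose[OF bounded_linear_scaleR_left]
      bounded_bilinear.bounded_linear_right[OF p_bounded_bilinear])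
  have "linear (\<lambda>(y, z). (y, z + f y))"
    by (rule linearI) (auto simp: linear_add[OF lin] linear_scale[OF lin] scaleR_add_right)
  then have "subspace C" unfolding C_def using C0 by (rule linear_subspace_image)
  moreover have "(y, w) \<in> complexify_rel C \<longleftrightarrow>
      y = act_right (complexify_form p) (laplace S \<zeta>) (cscale \<zeta> y - w)"
    if "\<alpha> + 2 < Re \<zeta>" for \<zeta> y w
  proof -
    let ?e = "\<Sum>j\<in>UNIV. cscale (complexify_form p (q' j, 0) y) (q j, 0)"
    have e: "?e = (f (fst y), f (snd y))"
      by (simp add: f_def cscale_def complexify_form_real[OF p_bounded_bilinear] prod_eq_iff
          fst_sum snd_sum)
    have "(y, w) \<in> complexify_rel C \<longleftrightarrow> (y, w - ?e) \<in> complexify_rel C\<^sub>0"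
      by (simp add: complexify_rel_def C_iff e)
    also have "\<dots> \<longleftrightarrow> y = act_right (complexify_form p) (laplace S\<^sub>0 \<zeta>) (cscale \<zeta> y - w + ?e)"
      using gen[of \<zeta> y "w - ?e"] that omega_less_alpha by (simp add: algebra_simps)
    also have "\<dots> \<longleftrightarrow> y = act_right (complexify_form p) (laplace S \<zeta>) (cscale \<zeta> y - w)"
      by (rule perturbed_resolvent_iff[OF that, symmetric])
    finally show ?thesis .
  qed
  ultimately have "is_twin_generator p S C"
    using twin_semigroup_perturbed unfolding is_twin_generator_def by blast
  moreover have "Domain C = Domain C\<^sub>0"
    unfolding C_def by force
  moreover have "C `` {y} = {z + f y | z. z \<in> C\<^sub>0 `` {y}}" for y
    unfolding C_def by force
  moreover have "S t = pert_semigroup' S\<^sub>0 q q' r t" if "0 \<le> t" for t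
    using that by (simp add: fun_eq_iff pert_semigroup_eq pert_semigroup'_eq)
  moreover have "twin_semigroup p S"
    using twin_semigroup_perturbed unfolding twin_semigroup_def by blast
  ultimately show ?thesis unfolding f_def by blast
qed

end
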